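(* Let $A=-\mathcal{A}$ be the opposite of a Sturm-Liouville operator on $X=L^2_\rho(a,b)$, with eigenvalues $\{\lambda_n\}_{n\in\mathbb{N}}$ and orthonormal basis of eigenfunctions $\{\phi_n\}_{n\in\mathbb{N}}$ of $X$, and let $\mu=\gamma+\epsilon$ with $\epsilon>0$ and $\lambda_n<\gamma<\infty$ for all $n$. Let $\alpha>0$. The $C_0$-semigroup $(T(t))_{t\geq0}$ generated by the operator $A$ (with domain $D(A)_\alpha$) on the space $X_\alpha=D((\mu I-A)^\alpha)$ is compact, i.e. $T(t)$ is a compact operator for all $t>0$, if and only if $\lim_{n\to\infty}e^{\lambda_n}=0$.
   Context: Let $a<b$ be real. Let $p,\frac{dp}{dz},q,\rho$ be real-valued continuous functions on $[a,b]$ with $\rho>0$ and $p>0$. $X=L^2_\rho(a,b)$ denotes the space $L^2(a,b)$ of real-valued square integrable functions equipped with the inner product $\langle f,g\rangle_\rho=\int_a^b f(z)g(z)\rho(z)\,dz$. The Sturm-Liouville operator is $(\mathcal{A}f)(z)=\frac{1}{\rho(z)}\left(\frac{d}{dz}\left(-p(z)\frac{df}{dz}(z)\right)+q(z)f(z)\right)$ with domain $D(\mathcal{A})=\{f\in H^2(a,b):\ \alpha_a\frac{df}{dz}(a)+\beta_a f(a)=0=\alpha_b\frac{df}{dz}(b)+\beta_b f(b)\}$, where $(\alpha_a,\beta_a)\neq(0,0)\neq(\alpha_b,\beta_b)$ are real pairs. Put $A=-\mathcal{A}$, $D(A)=D(\mathcal{A})$. Known facts: $A$ is self-adjoint on $X$;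 its spectrum consists only of simple real eigenvalues $\{\lambda_n\}_{n\in\mathbb{N}}$, bounded from above; the normalized eigenfunctions $\{\phi_n\}_{n\in\mathbb{N}}$ form an orthonormal basis of $X$; and $Af=\sum_{n=1}^\infty\lambda_n\langle f,\phi_n\rangle_\rho\phi_n$ for $f\in D(A)=\{f\in X:\ \sum_{n=1}^\infty\lambda_n^2\langle f,\phi_n\rangle_\rho^2<\infty\}$. For $\mu$ as in the claim and $\alpha>0$, $(\mu I-A)^\alpha f=\sum_{n=1}^\infty(\mu-\lambda_n)^\alpha\langle f,\phi_n\rangle_\rho\phi_n$ with domain $X_\alpha:=D((\mu I-A)^\alpha)=\{f\in X:\ \sum_{n=1}^\infty(\mu-\lambda_n)^{2\alpha}\langle f,\phi_n\rangle_\rho^2<\infty\}$, which is a real Hilbert space for the inner product $\langle f,g\rangle_\alpha=\langle(\mu I-A)^\alpha f,(\mu I-A)^\alpha g\rangle_\rho$. Put $\phi_{n,\alpha}=(\mu-\lambda_n)^{-\alpha}\phi_n$ and $D(A)_\alpha=\{f\in X_\alpha:\ \sum_{n=1}^\infty\lambda_n^2\langle f,\phi_{n,\alpha}\rangle_\alpha^2<\infty\}\subset D(A)$. The operator $A$ with domain $D(A)_\alpha$ is the infinitesimal generator of a $C_0$-semigroup $(T(t))_{t\ge0}$ on $X_\alpha$. *)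

theory Defs
  imports "HOL-Analysis.Analysis"
begin

subsection \<open>Measurable functions modulo equality almost everywhere\<close>

definition ae_eq :: "(real \<Rightarrow> real) \<Rightarrow> (real \<Rightarrow> real) \<Rightarrow> bool" where
  "ae_eq f g \<longleftrightarrow> f \<in> borel_measurable lebesgue \<and> g \<in> borel_measurable lebesgue \<and>
     (AE x in lebesgue. f x = g x)"

lemma part_equivp_ae_eq: "part_equivp ae_eq"
proof (rule part_equivpI)
  show "\<exists>x. ae_eq x x"
    by (rule exI[of _ "\<lambda>_. 0"]) (simp add: ae_eq_def)
  show "symp ae_eq"
    by (rule sympI) (auto simp: ae_eq_def elim: AE_mp)
  show "transp ae_eq"
    by (rule transpI) (auto simp: ae_eq_def elim: AE_mp)
qed

(* cls_of f is the class of a Lebesgue measurable f, and fn_of picks a representative of a class *)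
quotient_type lfun = "real \<Rightarrow> real" / partial: ae_eq
  morphisms fn_of cls_of
  by (rule part_equivp_ae_eq)

instantiation lfun :: real_vector
begin

lift_definition zero_lfun :: lfun is "\<lambda>_. 0"
  by (simp add: ae_eq_def)

lift_definition plus_lfun :: "lfun \<Rightarrow> lfun \<Rightarrow> lfun" is "\<lambda>f g x. f x + g x"
  by (auto simp: ae_eq_def)

lift_definition minus_lfun :: "lfun \<Rightarrow> lfun \<Rightarrow> lfun" is "\<lambda>f g x. f x - g x"
  by (auto simp: ae_eq_def)

lift_definition uminus_lfun :: "lfun \<Rightarrow> lfun" is "\<lambda>f x. - f x"
  by (auto simp: ae_eq_def)

lift_definition scaleR_lfun :: "real \<Rightarrow> lfun \<Rightarrow> lfun" is "\<lambda>c f x. c * f x"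
  by (auto simp: ae_eq_def)

instance
  by standard (transfer, auto simp: ae_eq_def algebra_simps)+

end

lemma fn_of_measurable: "fn_of f \<in> borel_measurable lebesgue"
  using Quotient3_rep_reflp[OF Quotient3_lfun, of f] by (simp add: ae_eq_def)

lemma cls_of_fn_of: "cls_of (fn_of f) = f"
  by (rule Quotient3_abs_rep[OF Quotient3_lfun])

lemma fn_of_cls_of:
  assumes "f \<in> borel_measurable lebesgue"
  shows "AE x in lebesgue. fn_of (cls_of f) x = f x"
proof -
  have "ae_eq f f"
    using assms by (simp add: ae_eq_def)
  then show ?thesis
    using Quotient3_rep_abs[OF Quotient3_lfun] by (simp add: ae_eq_def)
qed

subsection \<open>The space \<open>L\<^sup>2\<close> of an interval\<close>

(* functions on (a,b) are identified with their extensions by zero to the real line *)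
definition L2 :: "real \<Rightarrow> real \<Rightarrow> lfun set" where
  "L2 a b = {f. (AE z in lebesgue. z \<notin> {a..b} \<longrightarrow> fn_of f z = 0) \<and>
                integrable lebesgue (\<lambda>z. (fn_of f z)\<^sup>2)}"

definition class_on :: "real \<Rightarrow> real \<Rightarrow> (real \<Rightarrow> real) \<Rightarrow> lfun" where
  "class_on a b u = cls_of (\<lambda>z. indicator {a..b} z * u z)"

definition ip_weighted :: "real \<Rightarrow> real \<Rightarrow> (real \<Rightarrow> real) \<Rightarrow> lfun \<Rightarrow> lfun \<Rightarrow> real" where
  "ip_weighted a b \<rho> f g = (LINT z:{a..b}|lebesgue. fn_of f z * fn_of g z * \<rho> z)"

subsection \<open>Sturm-Liouville operators\<close>

(* derivative on [a,b], one-sided at the two end points *)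
definition D :: "real \<Rightarrow> real \<Rightarrow> (real \<Rightarrow> real) \<Rightarrow> real \<Rightarrow> real" where
  "D a b u z = vector_derivative u (at z within {a..b})"

definition abs_cont_on :: "real \<Rightarrow> real \<Rightarrow> (real \<Rightarrow> real) \<Rightarrow> bool" where
  "abs_cont_on a b u \<longleftrightarrow>
     (\<forall>\<epsilon>>0. \<exists>\<delta>>0. \<forall>I. finite I \<and> (\<forall>(s, t)\<in>I. a \<le> s \<and> s < t \<and> t \<le> b) \<and>
        pairwise (\<lambda>(s, t) (s', t'). disjnt {s<..<t} {s'<..<t'}) I \<and>
        (\<Sum>(s, t)\<in>I. t - s) < \<delta> \<longrightarrow> (\<Sum>(s, t)\<in>I. \<bar>u t - u s\<bar>) < \<epsilon>)"

(* H^2(a,b) in terms of continuously differentiable representatives: u' is absolutely continuous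
   on [a,b] and its almost everywhere defined derivative u'' is square integrable. The values of
   D a b (D a b u) on the null set where u'' does not exist are arbitrary and irrelevant. *)
definition H2_fun :: "real \<Rightarrow> real \<Rightarrow> (real \<Rightarrow> real) \<Rightarrow> bool" where
  "H2_fun a b u \<longleftrightarrow> u differentiable_on {a..b} \<and> abs_cont_on a b (D a b u) \<and>
     set_integrable lebesgue {a..b} (\<lambda>z. (D a b (D a b u) z)\<^sup>2)"

definition SL_domain :: "real \<Rightarrow> real \<Rightarrow> real \<Rightarrow> real \<Rightarrow> real \<Rightarrow> real \<Rightarrow> lfun set" where
  "SL_domain a b \<alpha>\<^sub>a \<beta>\<^sub>a \<alpha>\<^sub>b \<beta>\<^sub>b =
     {f. \<exists>u. H2_fun a b u \<and> f = class_on a b u \<and>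
           \<alpha>\<^sub>a * D a b u a + \<beta>\<^sub>a * u a = 0 \<and> \<alpha>\<^sub>b * D a b u b + \<beta>\<^sub>b * u b = 0}"

(* the representative u is unique on [a,b], being continuous there *)
definition SL_op ::
    "real \<Rightarrow> real \<Rightarrow> (real \<Rightarrow> real) \<Rightarrow> (real \<Rightarrow> real) \<Rightarrow> (real \<Rightarrow> real) \<Rightarrow> lfun \<Rightarrow> lfun" where
  "SL_op a b p q \<rho> f =
     (let u = (SOME u. H2_fun a b u \<and> f = class_on a b u) in
      class_on a b (\<lambda>z. 1 / \<rho> z * (D a b (\<lambda>y. - p y * D a b u y) z + q z * u z)))"

definition eigenvalues :: "'v::real_vector set \<Rightarrow> ('v \<Rightarrow> 'v) \<Rightarrow> real set" where
  "eigenvalues domA A = {l. \<exists>f\<in>domA. f \<noteq> 0 \<and> A f = l *\<^sub>R f}"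

subsection \<open>Orthonormal bases and fractional powers\<close>

text \<open>An inner product space is given by a carrier set \<open>X\<close>, a linear subspace of an ambient
  vector space, and a real-valued function \<open>ip\<close> of two arguments, which matters only on \<open>X\<close>.\<close>

definition ip_norm :: "('v \<Rightarrow> 'v \<Rightarrow> real) \<Rightarrow> 'v \<Rightarrow> real" where
  "ip_norm ip f = sqrt (ip f f)"

definition ip_sums ::
    "'v::real_vector set \<Rightarrow> ('v \<Rightarrow> 'v \<Rightarrow> real) \<Rightarrow> (nat \<Rightarrow> 'v) \<Rightarrow> 'v \<Rightarrow> bool" where
  "ip_sums X ip s f \<longleftrightarrow> f \<in> X \<and> (\<lambda>N. ip_norm ip (f - (\<Sum>n<N. s n))) \<longlonglongrightarrow> 0"

definition orthonormal_basis ::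
    "'v::real_vector set \<Rightarrow> ('v \<Rightarrow> 'v \<Rightarrow> real) \<Rightarrow> (nat \<Rightarrow> 'v) \<Rightarrow> bool" where
  "orthonormal_basis X ip \<phi> \<longleftrightarrow> range \<phi> \<subseteq> X \<and>
     (\<forall>m n. ip (\<phi> m) (\<phi> n) = (if m = n then 1 else 0)) \<and>
     (\<forall>f\<in>X. ip_sums X ip (\<lambda>n. ip f (\<phi> n) *\<^sub>R \<phi> n) f)"

(* (\<mu> I - A)^\<alpha> for the operator A with eigenvalues lam n and orthonormal eigenvectors \<phi> n *)
definition frac_power ::
    "'v::real_vector set \<Rightarrow> ('v \<Rightarrow> 'v \<Rightarrow> real) \<Rightarrow> (nat \<Rightarrow> real) \<Rightarrow> (nat \<Rightarrow> 'v) \<Rightarrow> real \<Rightarrow> real \<Rightarrow> 'v \<Rightarrow> 'v"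
  where
  "frac_power X ip lam \<phi> \<mu> \<alpha> f =
     (THE g. ip_sums X ip (\<lambda>n. ((\<mu> - lam n) powr \<alpha> * ip f (\<phi> n)) *\<^sub>R \<phi> n) g)"

definition X_frac ::
    "'v::real_vector set \<Rightarrow> ('v \<Rightarrow> 'v \<Rightarrow> real) \<Rightarrow> (nat \<Rightarrow> real) \<Rightarrow> (nat \<Rightarrow> 'v) \<Rightarrow> real \<Rightarrow> real \<Rightarrow> 'v set"
  where
  "X_frac X ip lam \<phi> \<mu> \<alpha> =
     {f \<in> X. summable (\<lambda>n. (\<mu> - lam n) powr (2 * \<alpha>) * (ip f (\<phi> n))\<^sup>2)}"

definition ip_frac ::
    "'v::real_vector set \<Rightarrow> ('v \<Rightarrow> 'v \<Rightarrow> real) \<Rightarrow> (nat \<Rightarrow> real) \<Rightarrow> (nat \<Rightarrow> 'v) \<Rightarrow> real \<Rightarrow> real \<Rightarrow>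
      'v \<Rightarrow> 'v \<Rightarrow> real"
  where
  "ip_frac X ip lam \<phi> \<mu> \<alpha> f g =
     ip (frac_power X ip lam \<phi> \<mu> \<alpha> f) (frac_power X ip lam \<phi> \<mu> \<alpha> g)"

definition phi_frac ::
    "(nat \<Rightarrow> real) \<Rightarrow> (nat \<Rightarrow> 'v::real_vector) \<Rightarrow> real \<Rightarrow> real \<Rightarrow> nat \<Rightarrow> 'v" where
  "phi_frac lam \<phi> \<mu> \<alpha> n = (\<mu> - lam n) powr (- \<alpha>) *\<^sub>R \<phi> n"

definition domain_frac ::
    "'v::real_vector set \<Rightarrow> ('v \<Rightarrow> 'v \<Rightarrow> real) \<Rightarrow> (nat \<Rightarrow> real) \<Rightarrow> (nat \<Rightarrow> 'v) \<Rightarrow> real \<Rightarrow> real \<Rightarrow> 'v set"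
  where
  "domain_frac X ip lam \<phi> \<mu> \<alpha> =
     {f \<in> X_frac X ip lam \<phi> \<mu> \<alpha>.
        summable (\<lambda>n. (lam n)\<^sup>2 * (ip_frac X ip lam \<phi> \<mu> \<alpha> f (phi_frac lam \<phi> \<mu> \<alpha> n))\<^sup>2)}"

subsection \<open>Bounded and compact operators, semigroups\<close>

text \<open>A normed space is given by a carrier set \<open>V\<close>, a linear subspace of an ambient vector
  space, and a function \<open>nrm\<close>, which matters only on \<open>V\<close>.\<close>

definition bounded_operator ::
    "'v::real_vector set \<Rightarrow> ('v \<Rightarrow> real) \<Rightarrow> ('v \<Rightarrow> 'v) \<Rightarrow> bool" where
  "bounded_operator V nrm K \<longleftrightarrow> K ` V \<subseteq> V \<and>
     (\<forall>f\<in>V. \<forall>g\<in>V. K (f + g) = K f + K g) \<and>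
     (\<forall>c. \<forall>f\<in>V. K (c *\<^sub>R f) = c *\<^sub>R K f) \<and>
     (\<exists>C. \<forall>f\<in>V. nrm (K f) \<le> C * nrm f)"

(* the case distinction ensures that the axioms of Metric_space, some of which are not
   relativized to the carrier, hold whenever nrm is a norm on V *)
definition norm_topology :: "'v::real_vector set \<Rightarrow> ('v \<Rightarrow> real) \<Rightarrow> 'v topology" where
  "norm_topology V nrm =
     Metric_space.mtopology V (\<lambda>f g. if f \<in> V \<and> g \<in> V then nrm (f - g) else 0)"

definition compact_operator ::
    "'v::real_vector set \<Rightarrow> ('v \<Rightarrow> real) \<Rightarrow> ('v \<Rightarrow> 'v) \<Rightarrow> bool" where
  "compact_operator V nrm K \<longleftrightarrow> bounded_operator V nrm K \<and>
     (\<forall>B. B \<subseteq> V \<and> (\<exists>r. \<forall>f\<in>B. nrm f \<le> r) \<longrightarrow>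
        compactin (norm_topology V nrm) (norm_topology V nrm closure_of (K ` B)))"

definition C0_semigroup ::
    "'v::real_vector set \<Rightarrow> ('v \<Rightarrow> real) \<Rightarrow> (real \<Rightarrow> 'v \<Rightarrow> 'v) \<Rightarrow> bool" where
  "C0_semigroup V nrm T \<longleftrightarrow>
     (\<forall>t\<ge>0. bounded_operator V nrm (T t)) \<and>
     (\<forall>f\<in>V. T 0 f = f) \<and>
     (\<forall>s\<ge>0. \<forall>t\<ge>0. \<forall>f\<in>V. T (s + t) f = T s (T t f)) \<and>
     (\<forall>f\<in>V. ((\<lambda>t. nrm (T t f - f)) \<longlongrightarrow> 0) (at_right 0))"

definition generator_graph ::
    "'v::real_vector set \<Rightarrow> ('v \<Rightarrow> real) \<Rightarrow> (real \<Rightarrow> 'v \<Rightarrow> 'v) \<Rightarrow> ('v \<times> 'v) set" where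
  "generator_graph V nrm T =
     {(f, g). f \<in> V \<and> g \<in> V \<and>
        ((\<lambda>t. nrm ((1 / t) *\<^sub>R (T t f - f) - g)) \<longlongrightarrow> 0) (at_right 0)}"

definition generates ::
    "'v::real_vector set \<Rightarrow> ('v \<Rightarrow> real) \<Rightarrow> 'v set \<Rightarrow> ('v \<Rightarrow> 'v) \<Rightarrow> (real \<Rightarrow> 'v \<Rightarrow> 'v) \<Rightarrow> bool" where
  "generates V nrm domA A T \<longleftrightarrow>
     C0_semigroup V nrm T \<and> generator_graph V nrm T = {(f, A f) | f. f \<in> domA}"

end

(* Everything is diagonal in the orthonormal basis of normalised eigenvectors of the space X_alpha.
   On an eigenvector the generator acts by multiplication with lambda_n, so T(t) acts on it by
   multiplication with exp (lambda_n t); by continuity T(t) is the diagonal operator with these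
   entries, and a bounded diagonal operator is compact iff its entries tend to 0. The Sturm-Liouville
   structure enters only through the eigenvalue equation; the analytic ingredients are the
   completeness of the weighted L2 space and the local boundedness of a C0-semigroup. *)

theory Submission
  imports Defs
begin

subsection \<open>Hilbert spaces given by a carrier\<close>

text \<open>The spaces X and X_\<alpha> are subsets of one vector type with different inner
  products, so the Hilbert space theory is built relative to a carrier and instantiated twice. The
  algebraic laws are demanded only on the carrier: the weighted product is a Bochner integral, which
  takes the default value 0 on non-integrable products and so need not be additive elsewhere.
  Completeness belongs to the carrier because \<open>orthonormal_basis\<close> only says that
  members have expansions, not that square summable coefficients come from a member. It serves three
  times: in uniform boundedness, in the surjectivity of the fractional power, and in replacing
  relative compactness by total boundedness. The semigroup is known only through its generator, so
  its exponential action on eigenvectors has to be recovered from the derivative at 0 and the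
  semigroup law. The inner product of X_\<alpha> makes (\<mu>I - A)^\<alpha> an isometry onto X that
  sends the n-th vector of \<open>phi_frac\<close> to \<open>\<phi> n\<close>; this transports both
  completeness and the basis.\<close>

locale hilbert_carrier =
  fixes V :: "'v::real_vector set" and ip :: "'v \<Rightarrow> 'v \<Rightarrow> real"
  assumes subspace: "subspace V"
    and ip_commute: "\<lbrakk>f \<in> V; g \<in> V\<rbrakk> \<Longrightarrow> ip f g = ip g f"
    and ip_add_left: "\<lbrakk>f \<in> V; g \<in> V; h \<in> V\<rbrakk> \<Longrightarrow> ip (f + g) h = ip f h + ip g h"
    and ip_scale_left: "\<lbrakk>f \<in> V; g \<in> V\<rbrakk> \<Longrightarrow> ip (c *\<^sub>R f) g = c * ip f g"
    and ip_pos: "\<lbrakk>f \<in> V; f \<noteq> 0\<rbrakk> \<Longrightarrow> ip f f > 0"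
    and complete: "\<lbrakk>\<And>n. s n \<in> V;
        \<And>e. e > 0 \<Longrightarrow> \<exists>M. \<forall>m\<ge>M. \<forall>n\<ge>M. ip_norm ip (s m - s n) < e\<rbrakk>
      \<Longrightarrow> \<exists>f\<in>V. (\<lambda>n. ip_norm ip (s n - f)) \<longlonglongrightarrow> 0"
begin

abbreviation nrm :: "'v \<Rightarrow> real" where "nrm \<equiv> ip_norm ip"

lemmas closed = subspace_0[OF subspace] subspace_add[OF subspace] subspace_scale[OF subspace]
  subspace_diff[OF subspace] subspace_neg[OF subspace]

lemma sum_closed: "(\<And>i. i \<in> F \<Longrightarrow> s i \<in> V) \<Longrightarrow> sum s F \<in> V"
  using subspace_sum[OF subspace] by blast

lemma ip_zero_left: "f \<in> V \<Longrightarrow> ip 0 f = 0"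
  using ip_scale_left[of 0 f 0] closed(1) by simp

lemma ip_diff_left: "\<lbrakk>f \<in> V; g \<in> V; h \<in> V\<rbrakk> \<Longrightarrow> ip (f - g) h = ip f h - ip g h"
  using ip_add_left[of f "- g" h] ip_scale_left[of g h "-1"] closed by simp

lemma ip_add_right: "\<lbrakk>f \<in> V; g \<in> V; h \<in> V\<rbrakk> \<Longrightarrow> ip h (f + g) = ip h f + ip h g"
  using ip_add_left ip_commute closed by simp

lemma ip_diff_right: "\<lbrakk>f \<in> V; g \<in> V; h \<in> V\<rbrakk> \<Longrightarrow> ip h (f - g) = ip h f - ip h g"
  using ip_diff_left ip_commute closed by simp

lemma ip_scale_right: "\<lbrakk>f \<in> V; g \<in> V\<rbrakk> \<Longrightarrow> ip g (c *\<^sub>R f) = c * ip g f"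
  using ip_scale_left ip_commute closed by simp

lemma ip_sum_left: "\<lbrakk>\<And>i. i \<in> F \<Longrightarrow> s i \<in> V; h \<in> V\<rbrakk> \<Longrightarrow> ip (sum s F) h = (\<Sum>i\<in>F. ip (s i) h)"
proof (induction F rule: infinite_finite_induct)
  case (insert i F)
  then show ?case using sum_closed[of F s] by (simp add: ip_add_left)
qed (simp_all add: ip_zero_left)

lemma ip_nonneg: "f \<in> V \<Longrightarrow> ip f f \<ge> 0"
  by (metis ip_pos ip_zero_left less_eq_real_def)

lemma nrm_nonneg: "f \<in> V \<Longrightarrow> nrm f \<ge> 0"
  by (simp add: ip_norm_def ip_nonneg)

lemma nrm_power2: "f \<in> V \<Longrightarrow> (nrm f)\<^sup>2 = ip f f"
  by (simp add: ip_norm_def ip_nonneg)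

lemma nrm_zero: "nrm 0 = 0"
  by (simp add: ip_norm_def ip_zero_left closed)

lemma nrm_pos: "\<lbrakk>f \<in> V; f \<noteq> 0\<rbrakk> \<Longrightarrow> nrm f > 0"
  by (simp add: ip_norm_def ip_pos)

lemma nrm_eq_0_iff: "f \<in> V \<Longrightarrow> nrm f = 0 \<longleftrightarrow> f = 0"
  using nrm_pos nrm_zero by force

lemma nrm_scale: "f \<in> V \<Longrightarrow> nrm (c *\<^sub>R f) = \<bar>c\<bar> * nrm f"
  by (simp add: ip_norm_def ip_scale_left ip_scale_right closed real_sqrt_mult flip: mult.assoc)

lemma nrm_minus_commute: "\<lbrakk>f \<in> V; g \<in> V\<rbrakk> \<Longrightarrow> nrm (f - g) = nrm (g - f)"
  using nrm_scale[of "f - g" "-1"] closed by simp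

text \<open>Subtracting from \<open>f\<close> its projection onto \<open>g\<close> leaves a vector
  of squared norm \<open>ip f f - (ip f g)\<^sup>2 / ip g g\<close>, which cannot be
  negative.\<close>

lemma Cauchy_Schwarz: 
  assumes "f \<in> V" "g \<in> V"
  shows "\<bar>ip f g\<bar> \<le> nrm f * nrm g"
proof (cases "g = 0")
  case True
  then show ?thesis using assms ip_zero_left[of f] ip_commute[of f 0] closed(1) nrm_zero by simp
next
  case False
  let ?c = "ip f g / ip g g"
  have pos: "ip g g > 0" using False assms ip_pos by blast
  have "0 \<le> ip (f - ?c *\<^sub>R g) (f - ?c *\<^sub>R g)"
    using assms by (intro ip_nonneg closed)
  also have "\<dots> = ip f f - (ip f g)\<^sup>2 / ip g g"
    using assms pos ip_commute[of f g]
    by (simp add: ip_diff_left ip_diff_right ip_scale_left ip_scale_right closed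
        power2_eq_square field_simps)
  finally have "(ip f g)\<^sup>2 \<le> ip f f * ip g g"
    using pos by (simp add: field_simps)
  then have "sqrt ((ip f g)\<^sup>2) \<le> sqrt (ip f f * ip g g)"
    by (rule real_sqrt_le_mono)
  then show ?thesis by (simp add: ip_norm_def real_sqrt_mult)
qed

lemma nrm_triangle: 
  assumes "f \<in> V" "g \<in> V"
  shows "nrm (f + g) \<le> nrm f + nrm g"
proof (rule power2_le_imp_le)
  have "(nrm (f + g))\<^sup>2 = (nrm f)\<^sup>2 + 2 * ip f g + (nrm g)\<^sup>2"
    using assms ip_commute[of f g]
    by (simp add: nrm_power2 closed ip_add_left ip_add_right)
  also have "\<dots> \<le> (nrm f + nrm g)\<^sup>2"
    using Cauchy_Schwarz[OF assms] by (simp add: power2_sum)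
  finally show "(nrm (f + g))\<^sup>2 \<le> (nrm f + nrm g)\<^sup>2" .
qed (use assms nrm_nonneg in auto)

lemma nrm_triangle_diff: "\<lbrakk>f \<in> V; g \<in> V; h \<in> V\<rbrakk> \<Longrightarrow> nrm (f - h) \<le> nrm (f - g) + nrm (g - h)"
  using nrm_triangle[of "f - g" "g - h"] closed by simp

lemma nrm_diff_le: "\<lbrakk>f \<in> V; g \<in> V\<rbrakk> \<Longrightarrow> nrm (f - g) \<le> nrm f + nrm g"
  using nrm_triangle[of f "- g"] nrm_scale[of g "-1"] closed by simp

lemma nrm_sum_le: "(\<And>i. i \<in> F \<Longrightarrow> s i \<in> V) \<Longrightarrow> nrm (sum s F) \<le> (\<Sum>i\<in>F. nrm (s i))"
proof (induction F rule: infinite_finite_induct)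
  case (insert i F)
  then have "nrm (s i + sum s F) \<le> nrm (s i) + nrm (sum s F)"
    by (intro nrm_triangle sum_closed) auto
  moreover have "nrm (sum s F) \<le> (\<Sum>i\<in>F. nrm (s i))"
    using insert by auto
  ultimately show ?case using insert by simp
qed (simp_all add: nrm_zero)

lemma limit_unique:
  assumes "f \<in> V" "g \<in> V" "\<And>n. s n \<in> V"
    and "(\<lambda>n. nrm (f - s n)) \<longlonglongrightarrow> 0" "(\<lambda>n. nrm (g - s n)) \<longlonglongrightarrow> 0"
  shows "f = g"
proof -
  have "nrm (f - g) \<le> nrm (f - s n) + nrm (g - s n)" for n
    using nrm_triangle_diff[of f "s n" g] nrm_minus_commute[of g "s n"] assms by simp
  moreover have "(\<lambda>n. nrm (f - s n) + nrm (g - s n)) \<longlonglongrightarrow> 0"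
    using tendsto_add[OF assms(4,5)] by simp
  ultimately have "nrm (f - g) \<le> 0"
    by (meson LIMSEQ_le_const)
  then show ?thesis
    using nrm_pos[of "f - g"] assms closed by force
qed

subsection \<open>Uniform boundedness\<close>

lemma bounded_operatorD:
  assumes "bounded_operator V nrm K"
  shows "f \<in> V \<Longrightarrow> K f \<in> V"
    and "\<lbrakk>f \<in> V; g \<in> V\<rbrakk> \<Longrightarrow> K (f + g) = K f + K g"
    and "f \<in> V \<Longrightarrow> K (c *\<^sub>R f) = c *\<^sub>R K f"
    and "\<lbrakk>f \<in> V; g \<in> V\<rbrakk> \<Longrightarrow> K (f - g) = K f - K g"
    and "K 0 = 0"
proof -
  show 1: "f \<in> V \<Longrightarrow> K f \<in> V" and 2: "\<lbrakk>f \<in> V; g \<in> V\<rbrakk> \<Longrightarrow> K (f + g) = K f + K g"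
    and 3: "f \<in> V \<Longrightarrow> K (c *\<^sub>R f) = c *\<^sub>R K f" for f g c
    using assms by (auto simp: bounded_operator_def)
  show "K (f - g) = K f - K g" if "f \<in> V" "g \<in> V"
    using 2[of f "- g"] 3[of g "-1"] that closed by simp
  show "K 0 = 0"
    using 3[of 0 0] closed by simp
qed

lemma bounded_operator_sum:
  assumes "bounded_operator V nrm K" "\<And>i. i \<in> F \<Longrightarrow> s i \<in> V"
  shows "K (sum s F) = (\<Sum>i\<in>F. K (s i))"
  using assms(2)
proof (induction F rule: infinite_finite_induct)
  case (insert i F)
  then show ?case
    using bounded_operatorD(2)[OF assms(1), of "s i" "sum s F"] sum_closed[of F s] by simp
qed (simp_all add: bounded_operatorD(5)[OF assms(1)])

text \<open>The constant in \<open>bounded_operator\<close> may be zero or negative; enlarging it to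
  \<open>\<bar>C\<bar> + 1\<close> gives one that can be divided by.\<close>

lemma bounded_operator_bound:
  assumes "bounded_operator V nrm K"
  obtains C where "C > 0" "\<And>f. f \<in> V \<Longrightarrow> nrm (K f) \<le> C * nrm f"
proof -
  obtain C where C: "\<forall>f\<in>V. nrm (K f) \<le> C * nrm f"
    using assms by (auto simp: bounded_operator_def)
  have "nrm (K f) \<le> (\<bar>C\<bar> + 1) * nrm f" if "f \<in> V" for f
  proof -
    have "nrm (K f) \<le> C * nrm f" using C that by blast
    also have "\<dots> \<le> (\<bar>C\<bar> + 1) * nrm f"
      using nrm_nonneg[OF that] by (intro mult_right_mono) auto
    finally show ?thesis .
  qed
  then show thesis using that[of "\<bar>C\<bar> + 1"] by auto
qed

text \<open>The proof is the nested ball argument behind Baire's theorem.\<close>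

lemma uniform_boundedness:
  fixes K :: "nat \<Rightarrow> 'v \<Rightarrow> 'v"
  assumes K: "\<And>n. bounded_operator V nrm (K n)"
    and ptw: "\<And>f. f \<in> V \<Longrightarrow> \<exists>C. \<forall>n. nrm (K n f) \<le> C"
  shows "\<exists>C. \<forall>n. \<forall>f\<in>V. nrm (K n f) \<le> C * nrm f"
proof (rule ccontr)
  assume "\<not> ?thesis"
  then have unb: "\<exists>n. \<exists>f\<in>V. nrm (K n f) > C * nrm f" for C
    by (meson not_le)
  \<comment> \<open>Every ball contains a smaller one, of at most half the radius, on which a single
    operator of the family has norm at least \<open>k\<close> at every point. The limit of such
    nested balls violates the pointwise bound.\<close>
  have step: "\<exists>x' r'. x' \<in> V \<and> 0 < r' \<and> r' \<le> r / 2 \<and> nrm (x - x') + r' \<le> r \<and>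
      (\<exists>n. \<forall>y\<in>V. nrm (y - x') \<le> r' \<longrightarrow> real k \<le> nrm (K n y))"
    if x: "x \<in> V" and r: "r > 0" for x r k
  proof -
    \<comment> \<open>Chosen so that \<open>f\<close>, rescaled to length \<open>r / 2\<close>, has
      an image of norm greater than \<open>k + 1\<close>.\<close>
    define C where "C = 2 * (real k + 1) / r"
    have "C > 0" using r by (simp add: C_def)
    obtain n f where f: "f \<in> V" and nf: "nrm (K n f) > C * nrm f"
      using unb by blast
    have "f \<noteq> 0"
    proof
      assume "f = 0"
      then show False using nf bounded_operatorD(5)[OF K] nrm_zero by simp
    qed
    then have pos: "nrm f > 0" using f nrm_pos by blast
    define h where "h = (r / 2 / nrm f) *\<^sub>R f"
    have h: "h \<in> V" using f closed h_def by simp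
    have nh: "nrm h = r / 2" using pos r f by (simp add: h_def nrm_scale)
    have "nrm (K n h) = r / 2 / nrm f * nrm (K n f)"
      using pos r f by (simp add: h_def nrm_scale bounded_operatorD[OF K])
    also have "\<dots> > r / 2 / nrm f * (C * nrm f)"
      using nf pos r by (intro mult_strict_left_mono) auto
    finally have Kh: "nrm (K n h) > real k + 1"
      using pos r by (simp add: C_def)
    \<comment> \<open>One of \<open>x + h\<close> and \<open>x - h\<close> serves: the difference of
      their images is twice the image of \<open>h\<close>, so both images cannot have norm at most
      \<open>k + 1\<close>.\<close>
    have "\<exists>x'\<in>V. nrm (x - x') = r / 2 \<and> nrm (K n x') > real k + 1"
    proof (rule ccontr)
      assume *: "\<not> ?thesis"
      have le: "nrm (K n (x + h)) \<le> real k + 1" "nrm (K n (x - h)) \<le> real k + 1"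
        using * x h nh closed nrm_minus_commute[of x "x + h"] by (auto simp: not_less Bex_def)
      have "2 *\<^sub>R K n h = K n (x + h) - K n (x - h)"
        using x h by (simp add: bounded_operatorD[OF K] scaleR_2)
      then have "2 * nrm (K n h) = nrm (K n (x + h) - K n (x - h))"
        using nrm_scale[of "K n h" 2] h bounded_operatorD(1)[OF K] by simp
      also have "\<dots> \<le> nrm (K n (x + h)) + nrm (K n (x - h))"
        using x h closed bounded_operatorD(1)[OF K] by (intro nrm_diff_le) auto
      finally show False using le Kh by simp
    qed
    then obtain x' where x': "x' \<in> V" "nrm (x - x') = r / 2" "nrm (K n x') > real k + 1"
      by blast
    obtain D where D: "D > 0" "\<And>f. f \<in> V \<Longrightarrow> nrm (K n f) \<le> D * nrm f"
      using bounded_operator_bound[OF K] by blast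
    \<comment> \<open>The bound \<open>r / 2\<close> keeps the new ball inside the old one and
      halves the radius; the bound \<open>1 / D\<close> lets \<open>K n\<close> vary by at most 1
      from its value at the centre, so that \<open>k + 1\<close> drops to no less than
      \<open>k\<close>.\<close>
    define r' where "r' = min (r / 2) (1 / D)"
    have "real k \<le> nrm (K n y)" if y: "y \<in> V" "nrm (y - x') \<le> r'" for y
    proof -
      have "K n x' = K n y + K n (x' - y)"
        using bounded_operatorD(2)[OF K y(1), of "x' - y" n] y x' closed(4) by simp
      then have "nrm (K n x') \<le> nrm (K n y) + nrm (K n (x' - y))"
        using nrm_triangle[of "K n y" "K n (x' - y)"] bounded_operatorD(1)[OF K] y x' closed(4)
        by metis
      also have "nrm (K n (x' - y)) \<le> D * nrm (x' - y)"
        using x'(1) y(1) by (intro D(2) closed(4))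
      also have "\<dots> \<le> D * (1 / D)"
        using D y x' nrm_minus_commute[of x' y] by (intro mult_left_mono) (auto simp: r'_def)
      finally show ?thesis using x' D by simp
    qed
    then show ?thesis
      using x' r D(1)
      by (intro exI[of _ x'] exI[of _ r']) (auto simp: r'_def intro!: exI[of _ n])
  qed
  have "\<exists>s::nat \<Rightarrow> 'v \<times> real. \<forall>k. (fst (s k) \<in> V \<and> snd (s k) > 0) \<and>
      (snd (s (Suc k)) \<le> snd (s k) / 2 \<and>
       nrm (fst (s k) - fst (s (Suc k))) + snd (s (Suc k)) \<le> snd (s k) \<and>
       (\<exists>n. \<forall>y\<in>V. nrm (y - fst (s (Suc k))) \<le> snd (s (Suc k)) \<longrightarrow> real k \<le> nrm (K n y)))"
    (is "\<exists>s. \<forall>k. ?P (s k) \<and> ?Q k (s k) (s (Suc k))")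
  proof (rule dependent_nat_choice[where P = "\<lambda>_. ?P" and Q = ?Q])
    show "\<exists>x. ?P x" by (rule exI[of _ "(0, 1)"]) (simp add: closed)
  next
    fix x :: "'v \<times> real" and k assume "?P x"
    then obtain x' r' where "x' \<in> V \<and> 0 < r' \<and> r' \<le> snd x / 2 \<and> nrm (fst x - x') + r' \<le> snd x \<and>
      (\<exists>n. \<forall>y\<in>V. nrm (y - x') \<le> r' \<longrightarrow> real k \<le> nrm (K n y))"
      using step[of "fst x" "snd x" k] by blast
    then show "\<exists>y. ?P y \<and> ?Q k x y"
      by (intro exI[of _ "(x', r')"]) simp
  qed
  then obtain s where s: "\<And>k. ?P (s k)" "\<And>k. ?Q k (s k) (s (Suc k))"
    by blast
  define x where "x k = fst (s k)" for k
  define r where "r k = snd (s k)" for k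
  have xV: "x k \<in> V" and rpos: "r k > 0" and half: "r (Suc k) \<le> r k / 2"
    and nest: "nrm (x k - x (Suc k)) + r (Suc k) \<le> r k" for k
    using s by (auto simp: x_def r_def)
  have big: "\<exists>n. \<forall>y\<in>V. nrm (y - x (Suc k)) \<le> r (Suc k) \<longrightarrow> real k \<le> nrm (K n y)" for k
    using s by (auto simp: x_def r_def)
  \<comment> \<open>Distance of the centres plus the inner radius is the quantity that telescopes
    along the chain of balls.\<close>
  have near: "nrm (x k - x (k + j)) + r (k + j) \<le> r k" for k j
  proof (induction j)
    case (Suc j)
    then show ?case
      using nest[of "k + j"] nrm_triangle_diff[OF xV[of k] xV[of "k + j"] xV[of "Suc (k + j)"]] 
      by simp
  qed (simp add: nrm_zero)
  have near': "nrm (x k - x j) \<le> r k" if "k \<le> j" for k j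
    using near[of k "j - k"] rpos[of j] that by simp
  have geometric: "r k \<le> r 0 * (1 / 2) ^ k" for k
  proof (induction k)
    case (Suc k)
    then show ?case using half[of k] by simp
  qed simp
  have r0: "r \<longlonglongrightarrow> 0"
  proof (rule tendsto_sandwich[where f = "\<lambda>_. 0"])
    show "(\<lambda>k. r 0 * (1 / 2) ^ k) \<longlonglongrightarrow> 0"
      by (intro tendsto_mult_right_zero LIMSEQ_power_zero) simp
    show "\<forall>\<^sub>F k in sequentially. r k \<le> r 0 * (1 / 2) ^ k"
      using geometric by (rule always_eventually[OF allI])
    show "\<forall>\<^sub>F k in sequentially. 0 \<le> r k"
      using less_imp_le[OF rpos] by (rule always_eventually[OF allI])
  qed (rule tendsto_const)
  have "\<exists>f\<in>V. (\<lambda>n. nrm (x n - f)) \<longlonglongrightarrow> 0"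
  proof (rule complete[OF xV])
    fix e :: real assume "e > 0"
    then obtain M where M: "r M < e / 2"
      using order_tendstoD(2)[OF r0, of "e / 2"] by (auto simp: eventually_sequentially)
    have "nrm (x m - x n) < e" if "m \<ge> M" "n \<ge> M" for m n
      using nrm_triangle_diff[OF xV[of m] xV[of M] xV[of n]] near'[OF that(1)] near'[OF that(2)] M
        nrm_minus_commute[OF xV[of m] xV[of M]] by simp
    then show "\<exists>M. \<forall>m\<ge>M. \<forall>n\<ge>M. nrm (x m - x n) < e" by blast
  qed
  then obtain f where f: "f \<in> V" "(\<lambda>n. nrm (x n - f)) \<longlonglongrightarrow> 0" by blast
  have "nrm (f - x k) \<le> r k" for k
  proof (rule LIMSEQ_le_const)
    show "(\<lambda>n. nrm (x n - f) + r k) \<longlonglongrightarrow> r k"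
      using tendsto_add[OF f(2) tendsto_const[of "r k"]] by simp
    show "\<exists>N. \<forall>n\<ge>N. nrm (f - x k) \<le> nrm (x n - f) + r k"
      using nrm_triangle_diff[OF f(1) xV xV[of k]] near' nrm_minus_commute f(1) xV
      by (smt (verit))
  qed
  then have "\<exists>n. real k \<le> nrm (K n f)" for k
    using big[of k] f(1) by blast
  moreover obtain C where "\<forall>n. nrm (K n f) \<le> C" using ptw f(1) by blast
  ultimately have "real k \<le> C" for k
    using order_trans by blast
  then show False
    using reals_Archimedean2[of C] by (meson not_le)
qed

subsection \<open>Semigroups\<close>

text \<open>If it failed, testing \<open>\<delta> = 1 / (k + 1)\<close> and \<open>M = k\<close>
  would give times tending to 0 along which the operator norms are unbounded. Strong continuity at 0
  bounds each orbit along these times, so uniform boundedness forbids this.\<close>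

lemma C0_semigroup_locally_bounded:
  assumes "C0_semigroup V nrm T"
  obtains \<delta> M where "\<delta> > 0" "\<And>t f. \<lbrakk>0 \<le> t; t \<le> \<delta>; f \<in> V\<rbrakk> \<Longrightarrow> nrm (T t f) \<le> M * nrm f"
proof (rule ccontr)
  assume contra: "\<not> thesis"
  have B: "\<And>t. t \<ge> 0 \<Longrightarrow> bounded_operator V nrm (T t)"
    and T0: "\<And>f. f \<in> V \<Longrightarrow> T 0 f = f"
    and cont: "\<And>f. f \<in> V \<Longrightarrow> ((\<lambda>t. nrm (T t f - f)) \<longlongrightarrow> 0) (at_right 0)"
    using assms by (auto simp: C0_semigroup_def)
  have "\<exists>t f. 0 \<le> t \<and> t \<le> 1 / real (Suc k) \<and> f \<in> V \<and> nrm (T t f) > real k * nrm f" for k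
    using that[of "1 / real (Suc k)" "real k"] contra by (force simp: not_le)
  then obtain t g where t: "\<And>k. 0 \<le> t k" "\<And>k. t k \<le> 1 / real (Suc k)" and g: "\<And>k. g k \<in> V"
    and big: "\<And>k. nrm (T (t k) (g k)) > real k * nrm (g k)"
    by metis
  have t0: "t \<longlonglongrightarrow> 0"
    by (rule tendsto_sandwich[OF _ _ tendsto_const LIMSEQ_Suc[OF lim_1_over_n]])
      (auto simp: t less_imp_le intro!: always_eventually t(2)[simplified])
  have "\<exists>C. \<forall>k. nrm (T (t k) f) \<le> C" if f: "f \<in> V" for f
  proof -
    have "\<forall>\<^sub>F s in at_right 0. nrm (T s f - f) < 1"
      using order_tendstoD(2)[OF cont[OF f], of 1] by simp
    then obtain d where d: "d > 0" "\<And>s. \<lbrakk>0 < s; s < d\<rbrakk> \<Longrightarrow> nrm (T s f - f) < 1"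
      by (auto simp: eventually_at_right_field)
    obtain k0 where k0: "\<And>k. k \<ge> k0 \<Longrightarrow> t k < d"
      using order_tendstoD(2)[OF t0 d(1)] by (auto simp: eventually_sequentially)
    have TV: "T (t k) f \<in> V" for k
      using bounded_operatorD(1)[OF B[OF t(1)]] f by blast
    \<comment> \<open>The finitely many indices below \<open>k0\<close> are absorbed by their sum;
      for the later ones \<open>T (t k) f\<close> lies within distance 1 of
      \<open>f\<close>.\<close>
    have "nrm (T (t k) f) \<le> nrm f + 1 + (\<Sum>j<k0. nrm (T (t j) f))" for k
    proof (cases "k < k0")
      case True
      then have "nrm (T (t k) f) \<le> (\<Sum>j<k0. nrm (T (t j) f))"
        by (intro member_le_sum) (auto simp: nrm_nonneg TV)
      then show ?thesis using nrm_nonneg[OF f] by simp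
    next
      case False
      have "nrm (T (t k) f - f) \<le> 1"
      \<comment> \<open>The filter \<open>at_right 0\<close> says nothing about time 0 itself, which
        the sequence may hit.\<close>
      proof (cases "t k = 0")
        case True
        then show ?thesis using T0 f nrm_zero by simp
      next
        case *: False
        then have "nrm (T (t k) f - f) < 1"
          using d(2)[of "t k"] k0[of k] t(1)[of k] False by linarith
        then show ?thesis by simp
      qed
      then have "nrm (T (t k) f) \<le> nrm f + 1"
        using nrm_triangle[of f "T (t k) f - f"] f TV closed by simp
      then show ?thesis
        using sum_nonneg[of "{..<k0}" "\<lambda>j. nrm (T (t j) f)"] nrm_nonneg[OF TV] by simp
    qed
    then show ?thesis by blast
  qed
  then obtain C where C: "\<forall>k. \<forall>f\<in>V. nrm (T (t k) f) \<le> C * nrm f"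
    using uniform_boundedness[of "\<lambda>k. T (t k)"] B t(1) by blast
  obtain k where "C < real k" using reals_Archimedean2 by blast
  then have "C * nrm (g k) \<le> real k * nrm (g k)"
    using nrm_nonneg[OF g[of k]] by (intro mult_right_mono) auto
  moreover have "nrm (T (t k) (g k)) \<le> C * nrm (g k)" using C g by blast
  ultimately show False using big[of k] by linarith
qed

text \<open>For small \<open>t\<close> the difference \<open>T(t)v - e\<^sup>l\<^sup>tv\<close> telescopes into \<open>n\<close> terms of size
  \<open>o(t/n)\<close>; local boundedness of the semigroup makes the estimate uniform.\<close>

lemma semigroup_eigenvector:
  assumes T: "C0_semigroup V nrm T" and gen: "(v, l *\<^sub>R v) \<in> generator_graph V nrm T"
    and "t \<ge> 0"
  shows "T t v = exp (l * t) *\<^sub>R v"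
proof -
  have B: "\<And>t. t \<ge> 0 \<Longrightarrow> bounded_operator V nrm (T t)"
    and T0: "\<And>f. f \<in> V \<Longrightarrow> T 0 f = f"
    and add: "\<And>s t f. \<lbrakk>s \<ge> 0; t \<ge> 0; f \<in> V\<rbrakk> \<Longrightarrow> T (s + t) f = T s (T t f)"
    using T by (auto simp: C0_semigroup_def)
  have v: "v \<in> V" and lim: "((\<lambda>h. nrm ((1 / h) *\<^sub>R (T h v - v) - l *\<^sub>R v)) \<longlongrightarrow> 0) (at_right 0)"
    using gen by (auto simp: generator_graph_def)
  have TV: "t \<ge> 0 \<Longrightarrow> f \<in> V \<Longrightarrow> T t f \<in> V" for t f
    using bounded_operatorD(1)[OF B] by blast
  obtain \<delta> M where \<delta>: "\<delta> > 0" and M0: "\<And>t f. \<lbrakk>0 \<le> t; t \<le> \<delta>; f \<in> V\<rbrakk> \<Longrightarrow> nrm (T t f) \<le> M * nrm f"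
    using C0_semigroup_locally_bounded[OF T] by blast
  define D where "D h = T h v - exp (l * h) *\<^sub>R v" for h
  have DV: "D h \<in> V" if "h \<ge> 0" for h
    using that TV v closed by (simp add: D_def)
  \<comment> \<open>The difference quotients at 0 of \<open>T h v\<close> and of
    \<open>exp (l * h) *\<^sub>R v\<close> both tend to \<open>l *\<^sub>R v\<close>, so the defect
    \<open>D h\<close> is o(h).\<close>
  have D0: "((\<lambda>h. nrm (D h) / h) \<longlongrightarrow> 0) (at_right 0)"
  proof (rule tendsto_sandwich[OF _ _ tendsto_const])
    have "((\<lambda>h. exp (l * h)) has_real_derivative l) (at 0)"
      by (auto intro!: derivative_eq_intros)
    then have "((\<lambda>h. (exp (l * h) - 1) / h) \<longlongrightarrow> l) (at 0)"
      by (simp add: has_field_derivative_iff)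
    then have "((\<lambda>h. (exp (l * h) - 1) / h) \<longlongrightarrow> l) (at_right 0)"
      by (rule filterlim_mono) (auto simp: at_le)
    then have "((\<lambda>h. \<bar>(exp (l * h) - 1) / h - l\<bar> * nrm v) \<longlongrightarrow> \<bar>l - l\<bar> * nrm v) (at_right 0)"
      by (intro tendsto_intros)
    then show "((\<lambda>h. nrm ((1 / h) *\<^sub>R (T h v - v) - l *\<^sub>R v) +
        \<bar>(exp (l * h) - 1) / h - l\<bar> * nrm v) \<longlongrightarrow> 0) (at_right 0)"
      using tendsto_add[OF lim] by fastforce
    have pos: "\<forall>\<^sub>F h in at_right 0. h > (0::real)"
      by (rule eventually_at_right_less)
    show "\<forall>\<^sub>F h in at_right 0. 0 \<le> nrm (D h) / h"
      using pos by eventually_elim (use DV nrm_nonneg in simp)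
    show "\<forall>\<^sub>F h in at_right 0. nrm (D h) / h \<le> nrm ((1 / h) *\<^sub>R (T h v - v) - l *\<^sub>R v) +
        \<bar>(exp (l * h) - 1) / h - l\<bar> * nrm v"
      using pos
    proof eventually_elim
      case (elim h)
      let ?x = "(1 / h) *\<^sub>R (T h v - v) - l *\<^sub>R v"
      let ?y = "((exp (l * h) - 1) / h - l) *\<^sub>R v"
      have "(1 / h) *\<^sub>R D h = ?x - ?y"
        using elim by (simp add: D_def algebra_simps diff_divide_distrib)
      then have "nrm (D h) / h = nrm (?x - ?y)"
        using nrm_scale[of "D h" "1 / h"] elim DV by simp
      also have "\<dots> \<le> nrm ?x + nrm ?y"
        using elim v TV closed by (intro nrm_diff_le) auto
      finally show ?case using v by (simp add: nrm_scale)
    qed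
  qed
  \<comment> \<open>With S = T(h) and the scalar e = exp(lh), this is S^k v - e^k v = sum over j < k
    of e^(k-1-j) S^j (S v - e v), where the last factor is \<open>D h\<close>.\<close>
  have iter: "T (real k * h) v - exp (l * (real k * h)) *\<^sub>R v
      = (\<Sum>j<k. exp (l * (real (k - Suc j) * h)) *\<^sub>R T (real j * h) (D h))" if h: "h \<ge> 0" for k h
  proof (induction k)
    case 0
    then show ?case by (simp add: T0 v)
  next
    case (Suc k)
    let ?S = "\<lambda>k. \<Sum>j<k. exp (l * (real (k - Suc j) * h)) *\<^sub>R T (real j * h) (D h)"
    have "?S (Suc k) = (\<Sum>j<k. exp (l * h) *\<^sub>R exp (l * (real (k - Suc j) * h)) *\<^sub>R T (real j * h) (D h))
        + T (real k * h) (D h)"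
      by (auto intro!: sum.cong simp: Suc_diff_Suc algebra_simps simp flip: exp_add)
    also have "\<dots> = exp (l * h) *\<^sub>R ?S k + T (real k * h) (D h)"
      by (simp add: scaleR_sum_right)
    also have "\<dots> = exp (l * h) *\<^sub>R (T (real k * h) v - exp (l * (real k * h)) *\<^sub>R v)
        + T (real k * h) (T h v - exp (l * h) *\<^sub>R v)"
      using Suc D_def by simp
    also have "\<dots> = T (real k * h) (T h v) - exp (l * (real (Suc k) * h)) *\<^sub>R v"
      using bounded_operatorD(3,4)[OF B[of "real k * h"]] h TV[of h v] v closed(3)
      by (simp add: scaleR_diff_right distrib_left distrib_right add.commute flip: exp_add)
    also have "T (real k * h) (T h v) = T (real (Suc k) * h) v"
      using add[of "real k * h" h v] h v by (simp add: algebra_simps)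
    finally show ?case by simp
  qed
  \<comment> \<open>Up to time \<open>\<delta>\<close> all operators \<open>T (real j * h)\<close>
    of the telescoping sum share the bound \<open>M\<close>.\<close>
  have small: "T s v = exp (l * s) *\<^sub>R v" if s: "0 < s" "s \<le> \<delta>" for s
  proof -
    \<comment> \<open>Each of the \<open>n\<close> terms is at most
      \<open>exp (\<bar>l\<bar> * s) * \<bar>M\<bar>\<close> times the norm of \<open>D h\<close>,
      and \<open>n\<close> equals \<open>s / h\<close>. Absolute values appear since the signs of
      \<open>l\<close> and \<open>M\<close> are unknown.\<close>
    define C where "C = exp (\<bar>l\<bar> * s) * \<bar>M\<bar> * s"
    have bound: "nrm (T s v - exp (l * s) *\<^sub>R v) \<le> C * (nrm (D h) / h)"
      if h: "h > 0" "real n * h = s" for n h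
    proof -
      have h0: "h \<ge> 0" using h by simp
      have jh: "real j * h \<le> s" "0 \<le> real j * h" if "j \<le> n" for j
      proof -
        have "real j * h \<le> real n * h" using that h0 by (intro mult_right_mono) auto
        then show "real j * h \<le> s" using h(2) by simp
        show "0 \<le> real j * h" using h0 by simp
      qed
      note DhV = DV[OF h0]
      have TD: "T (real j * h) (D h) \<in> V" if "j < n" for j
        using TV[OF jh(2) DhV] that by simp
      have "nrm (T s v - exp (l * s) *\<^sub>R v)
          = nrm (\<Sum>j<n. exp (l * (real (n - Suc j) * h)) *\<^sub>R T (real j * h) (D h))"
        using iter[OF h0, of n] unfolding h(2) by simp
      also have "\<dots> \<le> (\<Sum>j<n. nrm (exp (l * (real (n - Suc j) * h)) *\<^sub>R T (real j * h) (D h)))"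
        using TD closed(3) by (intro nrm_sum_le) blast
      also have "\<dots> \<le> (\<Sum>j<n. exp (\<bar>l\<bar> * s) * (\<bar>M\<bar> * nrm (D h)))"
      proof (rule sum_mono)
        fix j assume "j \<in> {..<n}"
        then have j: "j < n" by simp
        have "nrm (T (real j * h) (D h)) \<le> M * nrm (D h)"
          using jh[of j] j s DhV by (intro M0) auto
        also have "\<dots> \<le> \<bar>M\<bar> * nrm (D h)"
          using nrm_nonneg[OF DhV] by (intro mult_right_mono) auto
        finally have 1: "nrm (T (real j * h) (D h)) \<le> \<bar>M\<bar> * nrm (D h)" .
        have "\<bar>l * (real (n - Suc j) * h)\<bar> \<le> \<bar>l\<bar> * s"
          using jh[of "n - Suc j"] by (simp only: abs_mult) (intro mult_left_mono, auto simp: h0)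
        then have "exp (l * (real (n - Suc j) * h)) \<le> exp (\<bar>l\<bar> * s)"
          by simp
        then have "exp (l * (real (n - Suc j) * h)) * nrm (T (real j * h) (D h)) 
            \<le> exp (\<bar>l\<bar> * s) * (\<bar>M\<bar> * nrm (D h))"
          using 1 nrm_nonneg[OF TD[OF j]] by (intro mult_mono) auto
        then show "nrm (exp (l * (real (n - Suc j) * h)) *\<^sub>R T (real j * h) (D h))
            \<le> exp (\<bar>l\<bar> * s) * (\<bar>M\<bar> * nrm (D h))"
          using TD[OF j] by (simp add: nrm_scale)
      qed
      also have "\<dots> = C * (nrm (D h) / h)"
        using h(1) by (simp add: C_def h(2)[symmetric])
      finally show ?thesis .
    qed
    have "nrm (T s v - exp (l * s) *\<^sub>R v) \<le> C * (nrm (D (s / real (Suc k))) / (s / real (Suc k)))" for k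
      by (rule bound[of _ "Suc k"]) (use s in auto)
    moreover have "(\<lambda>k. C * (nrm (D (s / real (Suc k))) / (s / real (Suc k)))) \<longlonglongrightarrow> C * 0"
    proof (intro tendsto_mult tendsto_const filterlim_compose[OF D0])
      show "filterlim (\<lambda>k. s / real (Suc k)) (at_right 0) sequentially"
        using s LIMSEQ_Suc[OF lim_const_over_n[of s]]
        by (auto simp: filterlim_at intro!: always_eventually)
    qed
    ultimately have "nrm (T s v - exp (l * s) *\<^sub>R v) \<le> 0"
      by (intro LIMSEQ_le_const) auto
    then show ?thesis
      using nrm_pos[of "T s v - exp (l * s) *\<^sub>R v"] TV[of s v] s v closed by force
  qed
  \<comment> \<open>A longer time is cut into \<open>k\<close> equal pieces of length at most
    \<open>\<delta>\<close>; the eigenvector property passes through the semigroup law.\<close>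
  obtain k where k: "t / \<delta> < real k" using reals_Archimedean2 by blast
  then have kpos: "real k > 0" using \<open>t \<ge> 0\<close> \<delta> by (smt (verit) divide_nonneg_pos)
  show ?thesis
  proof (cases "t = 0")
    case True
    then show ?thesis using T0 v by simp
  next
    case False
    define h where "h = t / real k"
    have h: "0 < h" "h \<le> \<delta>" "real k * h = t"
      using False \<open>t \<ge> 0\<close> k kpos \<delta> by (auto simp: h_def field_simps)
    have "T (real j * h) v = exp (l * (real j * h)) *\<^sub>R v" for j
    proof (induction j)
      case (Suc j)
      have "T (real (Suc j) * h) v = T (real j * h) (T h v)"
        using add[of "real j * h" h v] h v by (simp add: algebra_simps)
      also have "\<dots> = exp (l * (real (Suc j) * h)) *\<^sub>R v"
        using Suc small[OF h(1,2)] bounded_operatorD(3)[OF B[of "real j * h"]] h v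
        by (simp add: algebra_simps flip: exp_add)
      finally show ?case .
    qed (simp add: T0 v)
    then show ?thesis using h(3) by metis
  qed
qed

end

section \<open>Orthonormal expansions, Parseval and Riesz-Fischer\<close>

locale hilbert_basis = hilbert_carrier V ip
  for V :: "'v::real_vector set" and ip :: "'v \<Rightarrow> 'v \<Rightarrow> real" +
  fixes \<phi> :: "nat \<Rightarrow> 'v"
  assumes basis: "orthonormal_basis V ip \<phi>"
begin

lemma basis_closed: "\<phi> n \<in> V"
  and ip_basis: "ip (\<phi> m) (\<phi> n) = (if m = n then 1 else 0)"
  and basis_expansion: "f \<in> V \<Longrightarrow> ip_sums V ip (\<lambda>n. ip f (\<phi> n) *\<^sub>R \<phi> n) f"
  using basis by (auto simp: orthonormal_basis_def)

lemma combination_closed: "(\<Sum>n\<in>F. x n *\<^sub>R \<phi> n) \<in> V"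
  by (intro sum_closed closed basis_closed)

lemma ip_combination: 
  "finite F \<Longrightarrow> ip (\<Sum>n\<in>F. x n *\<^sub>R \<phi> n) (\<phi> m) = (if m \<in> F then x m else 0)"
  by (subst ip_sum_left)
    (auto simp: closed basis_closed ip_scale_left ip_basis if_distrib if_distribR cong: if_cong)

lemma nrm_combination: 
  assumes "finite F"
  shows "(nrm (\<Sum>n\<in>F. x n *\<^sub>R \<phi> n))\<^sup>2 = (\<Sum>n\<in>F. (x n)\<^sup>2)"
proof -
  let ?s = "\<Sum>n\<in>F. x n *\<^sub>R \<phi> n"
  have "(nrm ?s)\<^sup>2 = (\<Sum>n\<in>F. ip (x n *\<^sub>R \<phi> n) ?s)"
    by (simp add: nrm_power2 combination_closed ip_sum_left closed basis_closed)
  also have "\<dots> = (\<Sum>n\<in>F. (x n)\<^sup>2)"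
  proof (intro sum.cong refl)
    fix n assume "n \<in> F"
    then show "ip (x n *\<^sub>R \<phi> n) ?s = (x n)\<^sup>2"
      using ip_commute[OF basis_closed combination_closed, of n x F] assms
      by (simp add: ip_scale_left basis_closed combination_closed ip_combination power2_eq_square)
  qed
  finally show ?thesis .
qed

lemma nrm_basis: "nrm (\<phi> n) = 1"
  by (simp add: ip_norm_def ip_basis)

text \<open>Once \<open>N > m\<close> the partial sum has m-th coefficient \<open>x m\<close>, so
  Cauchy-Schwarz bounds the discrepancy by the norm of the remainder.\<close>

lemma ip_sums_coefficient:
  assumes "ip_sums V ip (\<lambda>n. x n *\<^sub>R \<phi> n) g"
  shows "ip g (\<phi> m) = x m"
proof -
  have g: "g \<in> V" and lim: "(\<lambda>N. nrm (g - (\<Sum>n<N. x n *\<^sub>R \<phi> n))) \<longlonglongrightarrow> 0"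
    using assms by (auto simp: ip_sums_def)
  have "\<bar>ip g (\<phi> m) - x m\<bar> \<le> nrm (g - (\<Sum>n<N. x n *\<^sub>R \<phi> n))" if "N \<ge> Suc m" for N
    using Cauchy_Schwarz[of "g - (\<Sum>n<N. x n *\<^sub>R \<phi> n)" "\<phi> m"] that
    by (simp add: ip_diff_left g combination_closed basis_closed closed nrm_basis ip_combination)
  then have "\<bar>ip g (\<phi> m) - x m\<bar> \<le> 0"
    using LIMSEQ_le_const[OF lim] by blast
  then show ?thesis by simp
qed

lemma basis_eqI: 
  assumes "f \<in> V" "g \<in> V" "\<And>n. ip f (\<phi> n) = ip g (\<phi> n)"
  shows "f = g"
  using limit_unique[of f g "\<lambda>N. \<Sum>n<N. ip f (\<phi> n) *\<^sub>R \<phi> n"] basis_expansion[of f]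
    basis_expansion[of g] assms combination_closed by (simp add: ip_sums_def)

text \<open>Convergent expansions become statements about coefficients; fractional powers and
  diagonal operators are then handled without limits.\<close>

lemma ip_sums_basis_iff:
  "ip_sums V ip (\<lambda>n. x n *\<^sub>R \<phi> n) g \<longleftrightarrow> g \<in> V \<and> (\<forall>n. ip g (\<phi> n) = x n)"
  using ip_sums_coefficient basis_expansion[of g] by (auto simp: ip_sums_def)

lemma Parseval:
  assumes f: "f \<in> V"
  shows "(\<lambda>n. (ip f (\<phi> n))\<^sup>2) sums (nrm f)\<^sup>2"
proof -
  define s where "s N = (\<Sum>n<N. ip f (\<phi> n) *\<^sub>R \<phi> n)" for N
  have s: "s N \<in> V" for N by (simp add: s_def combination_closed)
  \<comment> \<open>Pythagoras: both \<open>ip (s N) f\<close> and \<open>ip (s N) (s N)\<close>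
    equal the partial sum of squares.\<close>
  have "(nrm (f - s N))\<^sup>2 = (nrm f)\<^sup>2 - (\<Sum>n<N. (ip f (\<phi> n))\<^sup>2)" for N
  proof -
    have "ip (s N) f = (\<Sum>n<N. (ip f (\<phi> n))\<^sup>2)"
      using f ip_commute[OF f basis_closed]
      by (simp add: s_def ip_sum_left closed basis_closed ip_scale_left power2_eq_square)
    moreover have "ip (s N) (s N) = (\<Sum>n<N. (ip f (\<phi> n))\<^sup>2)"
      using nrm_combination[of "{..<N}" "\<lambda>n. ip f (\<phi> n)"] nrm_power2[OF s[of N]] by (simp add: s_def)
    ultimately show ?thesis
      using f s[of N] ip_commute[OF f s[of N]]
      by (simp add: nrm_power2 closed ip_diff_left ip_diff_right)
  qed
  then have eq: "(\<Sum>n<N. (ip f (\<phi> n))\<^sup>2) = (nrm f)\<^sup>2 - (nrm (f - s N))\<^sup>2" for N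
    by simp
  have "(\<lambda>N. nrm (f - s N)) \<longlonglongrightarrow> 0"
    using basis_expansion[OF f] by (simp add: ip_sums_def s_def)
  then have "(\<lambda>N. (nrm f)\<^sup>2 - (nrm (f - s N))\<^sup>2) \<longlonglongrightarrow> (nrm f)\<^sup>2 - 0\<^sup>2"
    by (intro tendsto_intros)
  then show ?thesis by (simp add: sums_def eq)
qed

lemma abs_coefficient_le: "f \<in> V \<Longrightarrow> \<bar>ip f (\<phi> n)\<bar> \<le> nrm f"
  using Cauchy_Schwarz[OF _ basis_closed] by (simp add: nrm_basis)

text \<open>A block of the series has squared norm equal to the block of squares, so the partial
  sums are Cauchy and completeness supplies the vector.\<close>

lemma Riesz_Fischer:
  assumes sm: "summable (\<lambda>n. (x n)\<^sup>2)"
  shows "\<exists>g\<in>V. \<forall>n. ip g (\<phi> n) = x n"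
proof -
  define s where "s N = (\<Sum>n<N. x n *\<^sub>R \<phi> n)" for N
  have s: "s N \<in> V" for N by (simp add: s_def combination_closed)
  have diff: "(nrm (s m - s n))\<^sup>2 = (\<Sum>i=n..<m. (x i)\<^sup>2)" if "n \<le> m" for m n
  proof -
    have "s m - s n = (\<Sum>i=n..<m. x i *\<^sub>R \<phi> i)"
      using sum_diff_nat_ivl[of 0 n m "\<lambda>i. x i *\<^sub>R \<phi> i"] that by (simp add: s_def atLeast0LessThan)
    then show ?thesis by (simp add: nrm_combination)
  qed
  have "\<exists>g\<in>V. (\<lambda>N. nrm (s N - g)) \<longlonglongrightarrow> 0"
  proof (rule complete[OF s])
    fix e :: real assume e: "e > 0"
    then obtain M where M: "\<And>m n. m \<ge> M \<Longrightarrow> norm (\<Sum>i=m..<n. (x i)\<^sup>2) < e\<^sup>2"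
      using sm unfolding summable_Cauchy by (meson zero_less_power)
    have *: "nrm (s m - s n) < e" if "M \<le> n" "n \<le> m" for m n
    proof (rule power2_less_imp_less)
      show "(nrm (s m - s n))\<^sup>2 < e\<^sup>2"
        using M[of n m] that diff[of n m] by (simp add: sum_nonneg)
    qed (use e in simp)
    have "nrm (s m - s n) < e" if "m \<ge> M" "n \<ge> M" for m n
      using *[of n m] *[of m n] that nrm_minus_commute[OF s[of m] s[of n]] by linarith
    then show "\<exists>M. \<forall>m\<ge>M. \<forall>n\<ge>M. nrm (s m - s n) < e" by blast
  qed
  then obtain g where g: "g \<in> V" "(\<lambda>N. nrm (s N - g)) \<longlonglongrightarrow> 0" by blast
  then have "ip_sums V ip (\<lambda>n. x n *\<^sub>R \<phi> n) g"
    using nrm_minus_commute[OF s g(1)] by (simp add: ip_sums_def s_def)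
  then show ?thesis by (auto simp: ip_sums_basis_iff)
qed

subsection \<open>Compactness of diagonal operators\<close>

text \<open>Boundedness lets \<open>K\<close> act termwise on the expansion of \<open>f\<close>, and
  the coefficients of the resulting expansion are unique.\<close>

lemma diagonal_coefficient:
  assumes K: "bounded_operator V nrm K" and eig: "\<And>n. K (\<phi> n) = l n *\<^sub>R \<phi> n" and f: "f \<in> V"
  shows "ip (K f) (\<phi> m) = l m * ip f (\<phi> m)"
proof -
  define s where "s N = (\<Sum>n<N. ip f (\<phi> n) *\<^sub>R \<phi> n)" for N
  have s: "s N \<in> V" for N by (simp add: s_def combination_closed)
  obtain C where C: "\<And>g. g \<in> V \<Longrightarrow> nrm (K g) \<le> C * nrm g"
    using bounded_operator_bound[OF K] by blast
  have "K (s N) = (\<Sum>n<N. (ip f (\<phi> n) * l n) *\<^sub>R \<phi> n)" for N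
    by (simp add: s_def bounded_operator_sum[OF K] closed basis_closed bounded_operatorD(3)[OF K] eig)
  moreover have "(\<lambda>N. nrm (K f - K (s N))) \<longlonglongrightarrow> 0"
  proof (rule tendsto_sandwich[where f = "\<lambda>_. 0"])
    have "(\<lambda>N. nrm (f - s N)) \<longlonglongrightarrow> 0"
      using basis_expansion[OF f] by (simp add: ip_sums_def s_def)
    then show "(\<lambda>N. C * nrm (f - s N)) \<longlonglongrightarrow> 0"
      by (rule tendsto_mult_right_zero)
    have KV: "K f \<in> V" "K (s N) \<in> V" for N
      using bounded_operatorD(1)[OF K] f s by auto
    show "\<forall>\<^sub>F N in sequentially. nrm (K f - K (s N)) \<le> C * nrm (f - s N)"
      using C[OF closed(4)[OF f s]] bounded_operatorD(4)[OF K f s] by simp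
    show "\<forall>\<^sub>F N in sequentially. 0 \<le> nrm (K f - K (s N))"
      using nrm_nonneg[OF closed(4)[OF KV]] by simp
  qed (rule tendsto_const)
  ultimately have "ip_sums V ip (\<lambda>n. (ip f (\<phi> n) * l n) *\<^sub>R \<phi> n) (K f)"
    using bounded_operatorD(1)[OF K f] by (simp add: ip_sums_def)
  then show ?thesis by (simp add: ip_sums_basis_iff)
qed

text \<open>The coefficient sequences lie in a countable power of the interval [-B, B], compact by
  Tychonoff and hence sequentially compact; this stands in for a diagonal extraction. No vector with
  coefficients \<open>x\<close> is claimed: the later use only needs differences to become
  small.\<close>

lemma coefficientwise_convergent_subsequence:
  assumes f: "\<And>k::nat. f k \<in> V" and bound: "\<And>k. nrm (f k) \<le> B"
  shows "\<exists>x r. strict_mono r \<and> (\<forall>n. (\<lambda>k. ip (f (r k)) (\<phi> n)) \<longlonglongrightarrow> x n)"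
proof -
  define S where "S = PiE (UNIV::nat set) (\<lambda>_. cball (0::real) B)"
  have "compactin (product_topology (\<lambda>_. euclidean) UNIV) S"
    unfolding S_def compactin_PiE by (simp add: compactin_euclidean_iff)
  then have "compact S"
    by (simp add: euclidean_product_topology compactin_euclidean_iff)
  then have "seq_compact S"
    by (rule compact_imp_seq_compact)
  moreover have "(\<lambda>n. ip (f k) (\<phi> n)) \<in> S" for k
    using order_trans[OF abs_coefficient_le[OF f] bound] by (simp add: S_def PiE_UNIV_domain)
  ultimately obtain x r where r: "strict_mono r" and lim: "((\<lambda>k n. ip (f k) (\<phi> n)) \<circ> r) \<longlonglongrightarrow> x"
    unfolding seq_compact_def by metis
  have "(\<lambda>k. ip (f (r k)) (\<phi> n)) \<longlonglongrightarrow> x n" for n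
    using continuous_on_tendsto_compose[OF continuous_on_product_coordinates[of n] lim]
    by (simp add: o_def)
  then show ?thesis using r by blast
qed

text \<open>If \<open>l\<close> tends to 0, coefficientwise convergence controls finitely many
  coordinates of the images and small entries control the rest. Otherwise infinitely many images of
  basis vectors are orthogonal with norms bounded below, hence have no Cauchy subsequence.\<close>

lemma compact_diagonal_iff:
  assumes K: "bounded_operator V nrm K" and eig: "\<And>n. K (\<phi> n) = l n *\<^sub>R \<phi> n"
  shows "compact_operator V nrm K \<longleftrightarrow> l \<longlonglongrightarrow> 0"
proof -
  define d where "d f g = (if f \<in> V \<and> g \<in> V then nrm (f - g) else 0)" for f g
  interpret M: Metric_space V d
  proof
    show "0 \<le> d f g" for f g by (simp add: d_def nrm_nonneg closed)
    show "d f g = d g f" for f g by (simp add: d_def nrm_minus_commute)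
    show "d f g = 0 \<longleftrightarrow> f = g" if "f \<in> V" "g \<in> V" for f g
      using that nrm_eq_0_iff[of "f - g"] closed by (simp add: d_def)
    show "d f h \<le> d f g + d g h" if "f \<in> V" "g \<in> V" "h \<in> V" for f g h
      using that nrm_triangle_diff by (simp add: d_def)
  qed
  have top: "norm_topology V nrm = M.mtopology"
    by (simp add: norm_topology_def d_def[abs_def])
  have "M.mcomplete"
    unfolding M.mcomplete_def
  proof (intro allI impI)
    fix s assume "M.MCauchy s"
    then have s: "s n \<in> V" and C: "e > 0 \<Longrightarrow> \<exists>N. \<forall>m\<ge>N. \<forall>n\<ge>N. d (s m) (s n) < e" for n e
      by (auto simp: M.MCauchy_def)
    have "\<exists>f\<in>V. (\<lambda>n. nrm (s n - f)) \<longlonglongrightarrow> 0"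
      by (rule complete[OF s]) (use C s in \<open>simp add: d_def\<close>)
    then show "\<exists>f. limitin M.mtopology s f sequentially"
      using s by (auto simp: M.limitin_metric_dist_null d_def)
  qed
  \<comment> \<open>In a complete space relative compactness is total boundedness, which can be
    tested by Cauchy subsequences without producing limits.\<close>
  then have compact_iff: "compactin M.mtopology (M.mtopology closure_of (K ` B)) \<longleftrightarrow> M.mtotally_bounded (K ` B)"
    if "B \<subseteq> V" for B
    using that bounded_operatorD(1)[OF K] by (auto simp: M.mtotally_bounded_eq_compact_closure_of)
  show ?thesis
  proof
    assume l: "l \<longlonglongrightarrow> 0"
    show "compact_operator V nrm K"
      unfolding compact_operator_def top
    proof (intro conjI K allI impI)
      fix B assume "B \<subseteq> V \<and> (\<exists>R. \<forall>f\<in>B. nrm f \<le> R)"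
      then obtain R where B: "B \<subseteq> V" and R: "\<And>f. f \<in> B \<Longrightarrow> nrm f \<le> R" by blast
      have "\<exists>r. strict_mono r \<and> M.MCauchy (\<sigma> \<circ> r)" if "range \<sigma> \<subseteq> K ` B" for \<sigma> :: "nat \<Rightarrow> 'v"
      proof -
        have "\<forall>k. \<exists>g\<in>B. \<sigma> k = K g" using that by blast
        then obtain f where fB: "\<And>k. f k \<in> B" and \<sigma>: "\<And>k. \<sigma> k = K (f k)" by metis
        have f: "f k \<in> V" for k using fB B by blast
        have \<sigma>V: "\<sigma> k \<in> V" for k using \<sigma> f bounded_operatorD(1)[OF K] by simp
        obtain x r where r: "strict_mono r" and lim: "\<And>n. (\<lambda>k. ip (f (r k)) (\<phi> n)) \<longlonglongrightarrow> x n"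
          using coefficientwise_convergent_subsequence[of f R] f R fB by blast
        have R0: "R \<ge> 0" using R[OF fB[of 0]] nrm_nonneg[OF f[of 0]] by simp
        have "\<exists>J. \<forall>j\<ge>J. \<forall>k\<ge>J. d (\<sigma> (r j)) (\<sigma> (r k)) < e" if e: "e > 0" for e
        proof -
          \<comment> \<open>Differences of members of \<open>B\<close> have norm at most
            \<open>2 * R\<close>, so entries below \<open>\<eta>\<close> make the tail at most
            \<open>e / 2\<close> in norm; the \<open>+ 1\<close> covers
            \<open>R = 0\<close>.\<close>
          define \<eta> where "\<eta> = e / (2 * (2 * R + 1))"
          have \<eta>: "\<eta> > 0" using e R0 by (simp add: \<eta>_def)
          then obtain N where N: "\<And>n. n \<ge> N \<Longrightarrow> \<bar>l n\<bar> < \<eta>"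
            using LIMSEQ_D[OF l] by auto
          define u where "u j = (\<Sum>n<N. (l n * (ip (f (r j)) (\<phi> n) - x n))\<^sup>2)" for j
          have "u \<longlonglongrightarrow> (\<Sum>n<N. (l n * (x n - x n))\<^sup>2)"
            unfolding u_def by (intro tendsto_intros lim)
          then have "u \<longlonglongrightarrow> 0" by simp
          \<comment> \<open>The head is at most \<open>2 * u j + 2 * u k\<close>, thus below
            \<open>e\<^sup>2 / 2\<close>; with the tail bound \<open>e\<^sup>2 / 4\<close> the total
            stays below \<open>e\<^sup>2\<close>.\<close>
          then obtain J where J: "\<And>j. j \<ge> J \<Longrightarrow> u j < e\<^sup>2 / 8"
            using order_tendstoD(2)[of u 0 sequentially "e\<^sup>2 / 8"] e
            by (auto simp: eventually_sequentially)
          have "nrm (\<sigma> (r j) - \<sigma> (r k)) < e" if jk: "j \<ge> J" "k \<ge> J" for j k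
          proof (rule power2_less_imp_less)
            define h where "h = f (r j) - f (r k)"
            have h: "h \<in> V" using f closed by (simp add: h_def)
            have Kh: "K h = \<sigma> (r j) - \<sigma> (r k)"
              using bounded_operatorD(4)[OF K f f] by (simp add: h_def \<sigma>)
            have "nrm h \<le> 2 * R"
              using nrm_diff_le[OF f[of "r j"] f[of "r k"]] R[OF fB[of "r j"]] R[OF fB[of "r k"]]
              by (simp add: h_def)
            then have "\<eta> * nrm h \<le> \<eta> * (2 * R)"
              using \<eta> by (intro mult_left_mono) auto
            also have "\<dots> \<le> e / 2"
              using e R0 by (simp add: \<eta>_def field_simps)
            finally have "(\<eta> * nrm h)\<^sup>2 \<le> (e / 2)\<^sup>2"
              using \<eta> nrm_nonneg[OF h] by (intro power_mono) auto
            then have tail: "\<eta>\<^sup>2 * (nrm h)\<^sup>2 \<le> e\<^sup>2 / 4"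
              by (simp add: power_mult_distrib power_divide)
            let ?c = "\<lambda>n. (l n * ip h (\<phi> n))\<^sup>2"
            have "?c sums (nrm (K h))\<^sup>2"
              using Parseval[OF bounded_operatorD(1)[OF K h]] diagonal_coefficient[OF K eig h]
              by simp
            \<comment> \<open>A summable majorant: the exact head plus \<open>\<eta>\<^sup>2\<close>
              times all squared coefficients of \<open>h\<close>. Counting the head indices twice is
              harmless and lets Parseval apply unchanged.\<close>
            moreover have "(\<lambda>n. (if n \<in> {..<N} then ?c n else 0) + \<eta>\<^sup>2 * (ip h (\<phi> n))\<^sup>2) sums
                (sum ?c {..<N} + \<eta>\<^sup>2 * (nrm h)\<^sup>2)"
              by (rule sums_add[OF sums_If_finite_set[OF finite_lessThan] sums_mult[OF Parseval[OF h]]])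
            moreover have "?c n \<le> (if n \<in> {..<N} then ?c n else 0) + \<eta>\<^sup>2 * (ip h (\<phi> n))\<^sup>2" for n
            proof (cases "n < N")
              case False
              then have "(l n)\<^sup>2 \<le> \<eta>\<^sup>2"
                using N[of n] \<eta> by (simp add: abs_le_square_iff[symmetric])
              then show ?thesis
                using False by (simp add: power_mult_distrib mult_right_mono)
            qed simp
            ultimately have "(nrm (K h))\<^sup>2 \<le> sum ?c {..<N} + \<eta>\<^sup>2 * (nrm h)\<^sup>2"
              by (rule sums_le[rotated])
            moreover have "sum ?c {..<N} \<le> 2 * u j + 2 * u k"
              unfolding u_def sum_distrib_left sum.distrib[symmetric]
            proof (rule sum_mono)
              fix n
              have hn: "ip h (\<phi> n) = ip (f (r j)) (\<phi> n) - ip (f (r k)) (\<phi> n)"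
                by (simp add: h_def ip_diff_left f basis_closed)
              have *: "l n * ip h (\<phi> n) =
                  l n * (ip (f (r j)) (\<phi> n) - x n) - l n * (ip (f (r k)) (\<phi> n) - x n)"
                unfolding hn by (simp add: algebra_simps)
              show "?c n \<le> 2 * (l n * (ip (f (r j)) (\<phi> n) - x n))\<^sup>2 +
                  2 * (l n * (ip (f (r k)) (\<phi> n) - x n))\<^sup>2"
                unfolding * using sum_squares_bound by (smt (verit) power2_diff power2_sum zero_le_power2)
            qed
            moreover have "e\<^sup>2 > 0" using e by simp
            ultimately show "(nrm (\<sigma> (r j) - \<sigma> (r k)))\<^sup>2 < e\<^sup>2"
              using tail J[OF jk(1)] J[OF jk(2)] unfolding Kh by linarith
          qed (use e in simp)
          then show ?thesis using \<sigma>V by (auto simp: d_def)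
        qed
        then have "M.MCauchy (\<sigma> \<circ> r)"
          using \<sigma>V by (auto simp: M.MCauchy_def)
        then show ?thesis using r by blast
      qed
      then have "M.mtotally_bounded (K ` B)"
        using B bounded_operatorD(1)[OF K] by (auto simp: M.mtotally_bounded_sequentially)
      then show "compactin M.mtopology (M.mtopology closure_of K ` B)"
        using compact_iff[OF B] by blast
    qed
  next
    assume comp: "compact_operator V nrm K"
    show "l \<longlonglongrightarrow> 0"
    proof (rule ccontr)
      assume "\<not> l \<longlonglongrightarrow> 0"
      then obtain \<delta> where \<delta>: "\<delta> > 0" and "\<forall>N. \<exists>n\<ge>N. \<bar>l n\<bar> \<ge> \<delta>"
        unfolding LIMSEQ_iff by (auto simp: not_less)
      then have "infinite {n. \<bar>l n\<bar> \<ge> \<delta>}"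
        by (auto simp: infinite_nat_iff_unbounded_le)
      then obtain s :: "nat \<Rightarrow> nat" where s: "strict_mono s" "\<And>k. \<bar>l (s k)\<bar> \<ge> \<delta>"
        using infinite_enumerate by blast
      have "range \<phi> \<subseteq> V \<and> (\<exists>R. \<forall>f\<in>range \<phi>. nrm f \<le> R)"
        using basis_closed by (auto simp: nrm_basis)
      then have "M.mtotally_bounded (K ` range \<phi>)"
        using comp compact_iff[of "range \<phi>"] unfolding compact_operator_def top by blast
      moreover have "range (\<lambda>k. K (\<phi> (s k))) \<subseteq> K ` range \<phi>" by blast
      ultimately obtain r where r: "strict_mono r" and "M.MCauchy ((\<lambda>k. K (\<phi> (s k))) \<circ> r)"
        unfolding M.mtotally_bounded_sequentially by blast
      then obtain N where N: "\<And>m n. \<lbrakk>N \<le> m; N \<le> n\<rbrakk> \<Longrightarrow> d (K (\<phi> (s (r m)))) (K (\<phi> (s (r n)))) < \<delta>"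
        using \<delta> unfolding M.MCauchy_def o_def by blast
      define i where "i = s (r N)"
      define j where "j = s (r (Suc N))"
      have ij: "i \<noteq> j"
        using strict_monoD[OF s(1)] strict_monoD[OF r lessI[of N]] by (auto simp: i_def j_def dest: less_imp_neq)
      have KV: "K (\<phi> n) \<in> V" for n using bounded_operatorD(1)[OF K basis_closed] .
      \<comment> \<open>By orthogonality the other image does not contribute to the i-th coefficient
        of the difference.\<close>
      have "\<bar>l i\<bar> = \<bar>ip (K (\<phi> i) - K (\<phi> j)) (\<phi> i)\<bar>"
        using ij by (simp add: eig ip_diff_left ip_scale_left closed basis_closed ip_basis)
      also have "\<dots> \<le> nrm (K (\<phi> i) - K (\<phi> j))"
        by (intro abs_coefficient_le closed KV)
      also have "\<dots> < \<delta>"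
        using N[of N "Suc N"] KV by (simp add: i_def j_def d_def)
      finally show False using s(2)[of "r N"] by (simp add: i_def)
    qed
  qed
qed

text \<open>The entries of \<open>T t\<close> are the powers of \<open>exp (lam n)\<close> with
  exponent \<open>t\<close>, which tend to 0 for every positive \<open>t\<close> as soon as they do
  for \<open>t = 1\<close>.\<close>

lemma compact_semigroup_iff:
  assumes T: "C0_semigroup V nrm T"
    and eig: "\<And>n t. t \<ge> 0 \<Longrightarrow> T t (\<phi> n) = exp (lam n * t) *\<^sub>R \<phi> n"
  shows "(\<forall>t>0. compact_operator V nrm (T t)) \<longleftrightarrow> (\<lambda>n. exp (lam n)) \<longlonglongrightarrow> 0"
proof -
  have iff: "compact_operator V nrm (T t) \<longleftrightarrow> (\<lambda>n. exp (lam n * t)) \<longlonglongrightarrow> 0" if "t > 0" for t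
    using that T eig by (intro compact_diagonal_iff) (auto simp: C0_semigroup_def)
  have exp_t: "(\<lambda>n. exp (lam n * t)) \<longlonglongrightarrow> 0" if lim: "(\<lambda>n. exp (lam n)) \<longlonglongrightarrow> 0" and "t > 0" for t
  proof -
    have "(\<lambda>n. exp (lam n) powr t) \<longlonglongrightarrow> 0 powr t"
      using lim \<open>t > 0\<close> by (intro tendsto_powr2 tendsto_const) auto
    then show ?thesis
      using \<open>t > 0\<close> by (simp add: powr_def mult.commute)
  qed
  show ?thesis
  proof
    assume "\<forall>t>0. compact_operator V nrm (T t)"
    then have "compact_operator V nrm (T 1)" by simp
    then show "(\<lambda>n. exp (lam n)) \<longlonglongrightarrow> 0" using iff[of 1] by simp
  next
    assume "(\<lambda>n. exp (lam n)) \<longlonglongrightarrow> 0"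
    then show "\<forall>t>0. compact_operator V nrm (T t)" using iff exp_t by blast
  qed
qed

end

subsection \<open>Fractional powers\<close>

text \<open>The pulled back inner product turns \<open>S\<close> into a linear isometry onto
  \<open>X\<close>: injectivity gives definiteness, and surjectivity brings the limit of a Cauchy
  sequence back to \<open>V\<close>.\<close>

lemma hilbert_carrier_pullback:
  assumes "hilbert_carrier X ip" and V: "subspace V" and bij: "bij_betw S V X"
    and add: "\<And>f g. \<lbrakk>f \<in> V; g \<in> V\<rbrakk> \<Longrightarrow> S (f + g) = S f + S g"
    and scale: "\<And>c f. f \<in> V \<Longrightarrow> S (c *\<^sub>R f) = c *\<^sub>R S f"
  shows "hilbert_carrier V (\<lambda>f g. ip (S f) (S g))"
proof -
  interpret X: hilbert_carrier X ip by fact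
  have S: "S f \<in> X" if "f \<in> V" for f using bij that by (auto simp: bij_betw_def)
  have S0: "S 0 = 0" using scale[of 0 0] subspace_0[OF V] by simp
  have diff: "S (f - g) = S f - S g" if "f \<in> V" "g \<in> V" for f g
    using add[of f "- g"] scale[of g "-1"] subspace_neg[OF V] that by simp
  show ?thesis
  proof
    fix f assume f: "f \<in> V" "f \<noteq> 0"
    then have "S f \<noteq> S 0"
      using bij subspace_0[OF V] by (auto simp: bij_betw_def inj_on_def)
    then show "0 < ip (S f) (S f)" using S0 S f X.ip_pos by simp
  next
    fix s :: "nat \<Rightarrow> _"
    assume s: "\<And>n. s n \<in> V"
      and C: "\<And>e. e > 0 \<Longrightarrow> \<exists>M. \<forall>m\<ge>M. \<forall>n\<ge>M. ip_norm (\<lambda>f g. ip (S f) (S g)) (s m - s n) < e"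
    have "\<exists>g\<in>X. (\<lambda>n. X.nrm (S (s n) - g)) \<longlonglongrightarrow> 0"
      by (rule X.complete) (use s S C diff in \<open>simp_all add: ip_norm_def\<close>)
    then obtain g where "g \<in> X" and g: "(\<lambda>n. X.nrm (S (s n) - g)) \<longlonglongrightarrow> 0" by blast
    then obtain f where f: "f \<in> V" "g = S f" using bij by (auto simp: bij_betw_def)
    show "\<exists>f\<in>V. (\<lambda>n. ip_norm (\<lambda>f g. ip (S f) (S g)) (s n - f)) \<longlonglongrightarrow> 0"
      using f g s diff by (intro bexI[of _ f]) (simp_all add: ip_norm_def)
  qed (simp_all add: V S add scale X.ip_add_left X.ip_scale_left X.ip_commute)
qed

context hilbert_basis
begin

context
  fixes lam :: "nat \<Rightarrow> real" and \<gamma> \<epsilon> \<mu> \<alpha> :: real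
  assumes \<epsilon>: "\<epsilon> > 0" and lam: "\<And>n. lam n < \<gamma>" and \<mu>: "\<mu> = \<gamma> + \<epsilon>" and \<alpha>: "\<alpha> > 0"
begin

private abbreviation "w n \<equiv> (\<mu> - lam n) powr \<alpha>"
private abbreviation "V\<^sub>\<alpha> \<equiv> X_frac V ip lam \<phi> \<mu> \<alpha>"
private abbreviation "S \<equiv> frac_power V ip lam \<phi> \<mu> \<alpha>"
private abbreviation "\<psi> \<equiv> phi_frac lam \<phi> \<mu> \<alpha>"

text \<open>Each \<open>\<mu> - lam n\<close> exceeds \<epsilon>, which is the gain from shifting
  beyond the spectral bound \<gamma>: the weights stay away from 0 and may be divided by.\<close>

lemma weight_ge: "\<epsilon> powr \<alpha> \<le> w n" and weight_pos: "w n > 0" "\<epsilon> powr \<alpha> > 0"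
  using \<epsilon> lam[of n] \<mu> \<alpha> by (auto intro!: powr_mono2)

text \<open>The summability condition says that the weighted coefficients are square summable. By
  Parseval and Riesz-Fischer this means that they are the coefficients of a vector.\<close>

lemma X_frac_iff: "f \<in> V\<^sub>\<alpha> \<longleftrightarrow> f \<in> V \<and> (\<exists>g\<in>V. \<forall>n. ip g (\<phi> n) = w n * ip f (\<phi> n))"
proof -
  have "(\<mu> - lam n) powr (2 * \<alpha>) * (ip f (\<phi> n))\<^sup>2 = (w n * ip f (\<phi> n))\<^sup>2" for n
    by (simp add: power_mult_distrib power2_eq_square flip: powr_add)
  then have "f \<in> V\<^sub>\<alpha> \<longleftrightarrow> f \<in> V \<and> summable (\<lambda>n. (w n * ip f (\<phi> n))\<^sup>2)"
    by (simp add: X_frac_def)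
  moreover have "summable (\<lambda>n. (w n * ip f (\<phi> n))\<^sup>2)"
    if "g \<in> V" "\<forall>n. ip g (\<phi> n) = w n * ip f (\<phi> n)" for g
    using sums_summable[OF Parseval[OF that(1)]] that(2) by simp
  ultimately show ?thesis using Riesz_Fischer[of "\<lambda>n. w n * ip f (\<phi> n)"] by blast
qed

text \<open>This discharges the definite description in \<open>frac_power\<close>: existence comes
  from \<open>X_frac_iff\<close>, uniqueness from equality of coefficients.\<close>

lemma frac_power_eq_iff: "f \<in> V\<^sub>\<alpha> \<Longrightarrow> S f = g \<longleftrightarrow> g \<in> V \<and> (\<forall>n. ip g (\<phi> n) = w n * ip f (\<phi> n))"
proof -
  assume "f \<in> V\<^sub>\<alpha>"
  then obtain h where h: "h \<in> V" "\<forall>n. ip h (\<phi> n) = w n * ip f (\<phi> n)"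
    by (auto simp: X_frac_iff)
  then have "S f = h"
    unfolding frac_power_def ip_sums_basis_iff
    by (intro the_equality) (auto intro: basis_eqI)
  then show ?thesis using h basis_eqI by auto
qed

lemma frac_power_closed: "f \<in> V\<^sub>\<alpha> \<Longrightarrow> S f \<in> V"
  and ip_frac_power: "f \<in> V\<^sub>\<alpha> \<Longrightarrow> ip (S f) (\<phi> n) = w n * ip f (\<phi> n)"
  using frac_power_eq_iff by blast+

lemma X_frac_closed: "f \<in> V\<^sub>\<alpha> \<Longrightarrow> f \<in> V"
  by (simp add: X_frac_iff)

text \<open>Domain membership and value are obtained together from one comparison of coefficients,
  which reduces the linearity of \<open>S\<close> to that of \<open>ip\<close>.\<close>

lemma frac_power_eqI:
  "\<lbrakk>f \<in> V; g \<in> V; \<And>n. ip g (\<phi> n) = w n * ip f (\<phi> n)\<rbrakk> \<Longrightarrow> f \<in> V\<^sub>\<alpha> \<and> S f = g"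
  using X_frac_iff frac_power_eq_iff by blast

lemma frac_power_add: "\<lbrakk>f \<in> V\<^sub>\<alpha>; g \<in> V\<^sub>\<alpha>\<rbrakk> \<Longrightarrow> f + g \<in> V\<^sub>\<alpha> \<and> S (f + g) = S f + S g"
  by (rule frac_power_eqI)
    (simp_all add: X_frac_closed frac_power_closed closed ip_add_left basis_closed
      ip_frac_power distrib_left)

lemma frac_power_scale: "f \<in> V\<^sub>\<alpha> \<Longrightarrow> c *\<^sub>R f \<in> V\<^sub>\<alpha> \<and> S (c *\<^sub>R f) = c *\<^sub>R S f"
  by (rule frac_power_eqI)
    (simp_all add: X_frac_closed frac_power_closed closed ip_scale_left basis_closed ip_frac_power)

text \<open>Positive weights can be cancelled, whence injectivity. Dividing coefficients by weights
  of at least \<open>\<epsilon> powr \<alpha>\<close> preserves square summability, so Riesz-Fischer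
  yields preimages.\<close>

lemma frac_power_bij: "bij_betw S V\<^sub>\<alpha> V"
  unfolding bij_betw_def
proof
  show "inj_on S V\<^sub>\<alpha>"
  proof (rule inj_onI)
    fix f g assume fg: "f \<in> V\<^sub>\<alpha>" "g \<in> V\<^sub>\<alpha>" "S f = S g"
    have "ip f (\<phi> n) = ip g (\<phi> n)" for n
      using ip_frac_power[OF fg(1), of n] ip_frac_power[OF fg(2), of n] fg(3) weight_pos(1)[of n]
      by simp
    then show "f = g" using basis_eqI fg X_frac_closed by blast
  qed
  have "g \<in> S ` V\<^sub>\<alpha>" if g: "g \<in> V" for g
  proof -
    have "\<bar>ip g (\<phi> n) / w n\<bar> \<le> \<bar>ip g (\<phi> n) / \<epsilon> powr \<alpha>\<bar>" for n
      using weight_ge[of n] weight_pos(1)[of n] weight_pos(2) by (simp add: abs_divide divide_left_mono mult_pos_pos)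
    then have le: "(ip g (\<phi> n) / w n)\<^sup>2 \<le> (ip g (\<phi> n))\<^sup>2 / (\<epsilon> powr \<alpha>)\<^sup>2" for n
      by (simp only: abs_le_square_iff power_divide)
    have "summable (\<lambda>n. (ip g (\<phi> n))\<^sup>2 / (\<epsilon> powr \<alpha>)\<^sup>2)"
      using sums_summable[OF Parseval[OF g]] by (rule summable_divide)
    then have "summable (\<lambda>n. (ip g (\<phi> n) / w n)\<^sup>2)"
    proof (rule summable_comparison_test')
      show "norm ((ip g (\<phi> n) / w n)\<^sup>2) \<le> (ip g (\<phi> n))\<^sup>2 / (\<epsilon> powr \<alpha>)\<^sup>2" for n
        using le[of n] by simp
    qed
    then obtain f where f: "f \<in> V" "\<And>n. ip f (\<phi> n) = ip g (\<phi> n) / w n"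
      using Riesz_Fischer[of "\<lambda>n. ip g (\<phi> n) / w n"] by blast
    have "f \<in> V\<^sub>\<alpha> \<and> S f = g"
      using f g weight_pos(1) by (intro frac_power_eqI) (simp_all add: less_imp_neq[symmetric])
    then show ?thesis by force
  qed
  then show "S ` V\<^sub>\<alpha> = V" using frac_power_closed by blast
qed

lemma frac_power_basis: "\<phi> n \<in> V\<^sub>\<alpha> \<and> S (\<phi> n) = w n *\<^sub>R \<phi> n"
  by (rule frac_power_eqI) (simp_all add: basis_closed closed ip_scale_left ip_basis)

lemma frac_power_phi_frac: "\<psi> n \<in> V\<^sub>\<alpha> \<and> S (\<psi> n) = \<phi> n"
  using frac_power_scale[of "\<phi> n" "(\<mu> - lam n) powr - \<alpha>"] frac_power_basis[of n] lam[of n] \<mu> \<epsilon>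
  by (simp add: phi_frac_def flip: powr_add)

lemma subspace_X_frac: "subspace V\<^sub>\<alpha>"
  using frac_power_add frac_power_scale frac_power_eqI[of 0 0] closed
  by (auto simp: subspace_def ip_zero_left basis_closed)

text \<open>The isometry \<open>S\<close> carries the expansion of \<open>f\<close> in
  \<open>\<psi>\<close> to that of \<open>S f\<close> in \<open>\<phi>\<close>, so the remainders
  have equal norms.\<close>

lemma hilbert_basis_X_frac: "hilbert_basis V\<^sub>\<alpha> (ip_frac V ip lam \<phi> \<mu> \<alpha>) \<psi>"
proof -
  have eq: "ip_frac V ip lam \<phi> \<mu> \<alpha> = (\<lambda>f g. ip (S f) (S g))"
    by (intro ext) (simp add: ip_frac_def)
  interpret H: hilbert_carrier V\<^sub>\<alpha> "\<lambda>f g. ip (S f) (S g)"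
    using hilbert_carrier_axioms subspace_X_frac frac_power_bij
    by (rule hilbert_carrier_pullback) (simp_all add: frac_power_add frac_power_scale)
  show ?thesis
    unfolding eq
  proof
    have "ip_sums V\<^sub>\<alpha> (\<lambda>f g. ip (S f) (S g)) (\<lambda>n. ip (S f) (\<phi> n) *\<^sub>R \<psi> n) f" if f: "f \<in> V\<^sub>\<alpha>" for f
    proof -
      \<comment> \<open>Additivity of \<open>S\<close> is available on
        \<open>V\<^sub>\<alpha>\<close> only, so one term is split off at a time, with membership of
        the remainder checked at each stage.\<close>
      have "S (f - (\<Sum>n<N. ip (S f) (\<phi> n) *\<^sub>R \<psi> n)) = S f - (\<Sum>n<N. ip (S f) (\<phi> n) *\<^sub>R \<phi> n)" for N
      proof (induction N)
        case (Suc N)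
        let ?h = "f - (\<Sum>n<N. ip (S f) (\<phi> n) *\<^sub>R \<psi> n)" and ?c = "ip (S f) (\<phi> N)"
        have h: "?h \<in> V\<^sub>\<alpha>"
          using frac_power_phi_frac by (intro H.closed(3,4) H.sum_closed f) blast
        have "S (?h + (- ?c) *\<^sub>R \<psi> N) = S ?h + (- ?c) *\<^sub>R \<phi> N"
          using h frac_power_phi_frac[of N] frac_power_add[of ?h "(- ?c) *\<^sub>R \<psi> N"]
            frac_power_scale[of "\<psi> N" "- ?c"] by simp
        then show ?case using Suc by (simp add: algebra_simps)
      qed simp
      then show ?thesis
        using f basis_expansion[OF frac_power_closed[OF f]] by (simp add: ip_sums_def ip_norm_def)
    qed
    then show "orthonormal_basis V\<^sub>\<alpha> (\<lambda>f g. ip (S f) (S g)) \<psi>"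
      using frac_power_phi_frac by (auto simp: orthonormal_basis_def ip_basis)
  qed
qed

text \<open>Only the coefficient with index \<open>n\<close> is nonzero. The vectors
  \<open>\<phi> n\<close> are chosen because the eigenvalue equation of the generator is given for
  them.\<close>

lemma basis_in_domain_frac: "\<phi> n \<in> domain_frac V ip lam \<phi> \<mu> \<alpha>"
proof -
  have "summable (\<lambda>m. (lam m)\<^sup>2 * (ip_frac V ip lam \<phi> \<mu> \<alpha> (\<phi> n) (\<psi> m))\<^sup>2)"
    by (rule summable_finite[of "{n}"])
      (simp_all add: ip_frac_def frac_power_basis frac_power_phi_frac ip_scale_left basis_closed ip_basis)
  then show ?thesis using frac_power_basis by (simp add: domain_frac_def)
qed

end
end

subsection \<open>Completeness of the weighted space \<open>L\<^sup>2\<close>\<close>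

text \<open>The classical argument: a rapidly Cauchy subsequence converges almost everywhere, since
  its increments are summable in L1 of a finite measure, and Fatou's lemma upgrades this to
  convergence of the whole sequence in the mean square.\<close>

lemma L2_completeness:
  fixes u :: "nat \<Rightarrow> 'a \<Rightarrow> real"
  assumes "finite_measure M"
    and [measurable]: "\<And>n. u n \<in> borel_measurable M"
    and sq: "\<And>n. integrable M (\<lambda>x. (u n x)\<^sup>2)"
    and Cauchy: "\<And>e. e > 0 \<Longrightarrow> \<exists>K. \<forall>m\<ge>K. \<forall>n\<ge>K. (\<integral>x. (u m x - u n x)\<^sup>2 \<partial>M) < e"
  obtains v where "v \<in> borel_measurable M" "integrable M (\<lambda>x. (v x)\<^sup>2)"
    "(\<lambda>n. \<integral>x. (u n x - v x)\<^sup>2 \<partial>M) \<longlonglongrightarrow> 0"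
proof -
  interpret finite_measure M by fact
  have sqdiff: "integrable M (\<lambda>x. (u m x - u n x)\<^sup>2)" for m n
  proof (rule Bochner_Integration.integrable_bound)
    show "integrable M (\<lambda>x. 2 * (u m x)\<^sup>2 + 2 * (u n x)\<^sup>2)"
      using sq by simp
    have "(u m x - u n x)\<^sup>2 \<le> 2 * (u m x)\<^sup>2 + 2 * (u n x)\<^sup>2" for x
      using zero_le_power2[of "u m x + u n x"] unfolding power2_diff power2_sum by linarith
    then show "AE x in M. norm ((u m x - u n x)\<^sup>2) \<le> norm (2 * (u m x)\<^sup>2 + 2 * (u n x)\<^sup>2)"
      by simp
  qed measurable
  \<comment> \<open>The rate 4^(-k) leaves 2^(-k) after the factor 2^k that is spent in passing from
    squares to first powers.\<close>
  have "\<exists>r::nat \<Rightarrow> nat. \<forall>k. (\<forall>m\<ge>r k. \<forall>n\<ge>r k. (\<integral>x. (u m x - u n x)\<^sup>2 \<partial>M) < (1 / 4) ^ k) \<and> r k < r (Suc k)"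
  proof (rule dependent_nat_choice)
    show "\<exists>K. \<forall>m\<ge>K. \<forall>n\<ge>K. (\<integral>x. (u m x - u n x)\<^sup>2 \<partial>M) < (1 / 4) ^ 0"
      using Cauchy[of 1] by simp
    fix K' and k :: nat
    obtain K where "\<forall>m\<ge>K. \<forall>n\<ge>K. (\<integral>x. (u m x - u n x)\<^sup>2 \<partial>M) < (1 / 4) ^ Suc k"
      using Cauchy[of "(1 / 4) ^ Suc k"] by auto
    then show "\<exists>K. (\<forall>m\<ge>K. \<forall>n\<ge>K. (\<integral>x. (u m x - u n x)\<^sup>2 \<partial>M) < (1 / 4) ^ Suc k) \<and> K' < K"
      by (intro exI[of _ "max K (Suc K')"]) auto
  qed
  then obtain r where r: "\<And>k m n. \<lbrakk>m \<ge> r k; n \<ge> r k\<rbrakk> \<Longrightarrow> (\<integral>x. (u m x - u n x)\<^sup>2 \<partial>M) < (1 / 4) ^ k"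
    and "\<And>k. r k < r (Suc k)" by blast
  then have mono: "strict_mono r" by (simp add: strict_mono_Suc_iff)
  define d where "d k x = \<bar>u (r (Suc k)) x - u (r k) x\<bar>" for k x
  have [measurable]: "d k \<in> borel_measurable M" for k
    unfolding d_def by measurable
  text \<open>\<open>d\<^sub>k \<le> 2\<^sup>k d\<^sub>k\<^sup>2 + 2\<^sup>-\<^sup>k\<close> turns the \<open>L\<^sup>2\<close> bound \<open>4\<^sup>-\<^sup>k\<close> into a summable \<open>L\<^sup>1\<close> bound.\<close>
  have d_le: "(\<integral>\<^sup>+x. ennreal (d k x) \<partial>M) \<le> ennreal ((1 / 2) ^ k * (1 + measure M (space M)))" for k
  proof -
    have "d k x \<le> 2 ^ k * (d k x)\<^sup>2 + (1 / 2) ^ k" for x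
    proof -
      have "0 \<le> (2 ^ k * d k x - 1)\<^sup>2" by simp
      then have "2 ^ k * d k x * 2 \<le> (2 ^ k * d k x)\<^sup>2 + 1"
        by (simp add: power2_diff)
      moreover have "0 \<le> 2 ^ k * d k x" by (simp add: d_def)
      ultimately have "2 ^ k * d k x \<le> (2 ^ k * d k x)\<^sup>2 + 1"
        by linarith
      then show ?thesis by (simp add: power2_eq_square field_simps power_one_over)
    qed
    then have "(\<integral>\<^sup>+x. ennreal (d k x) \<partial>M) \<le> (\<integral>\<^sup>+x. ennreal (2 ^ k * (d k x)\<^sup>2 + (1 / 2) ^ k) \<partial>M)"
      by (intro nn_integral_mono ennreal_leI)
    also have "\<dots> = ennreal (\<integral>x. 2 ^ k * (d k x)\<^sup>2 + (1 / 2) ^ k \<partial>M)"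
      using sqdiff by (intro nn_integral_eq_integral) (simp_all add: d_def)
    also have "(\<integral>x. 2 ^ k * (d k x)\<^sup>2 + (1 / 2) ^ k \<partial>M)
        = 2 ^ k * (\<integral>x. (u (r (Suc k)) x - u (r k) x)\<^sup>2 \<partial>M) + (1 / 2) ^ k * measure M (space M)"
      using sqdiff by (simp add: d_def)
    also have "\<dots> \<le> 2 ^ k * (1 / 4) ^ k + (1 / 2) ^ k * measure M (space M)"
      using r[of k "r (Suc k)" "r k"] strict_monoD[OF mono lessI[of k]] by simp
    also have "\<dots> = (1 / 2) ^ k * (1 + measure M (space M))"
      by (simp add: distrib_left flip: power_mult_distrib)
    finally show ?thesis by (simp add: ennreal_leI)
  qed
  have "(\<integral>\<^sup>+x. (\<Sum>k. ennreal (d k x)) \<partial>M) = (\<Sum>k. \<integral>\<^sup>+x. ennreal (d k x) \<partial>M)"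
    by (rule nn_integral_suminf) measurable
  also have "\<dots> \<le> (\<Sum>k. ennreal ((1 / 2) ^ k * (1 + measure M (space M))))"
    by (intro suminf_le d_le) auto
  also have "\<dots> < \<infinity>"
    by (subst suminf_ennreal2)
      (auto intro!: summable_mult2 summable_geometric simp: ennreal_less_top)
  finally have "(\<integral>\<^sup>+x. (\<Sum>k. ennreal (d k x)) \<partial>M) \<noteq> \<infinity>" by simp
  then have "AE x in M. (\<Sum>k. ennreal (d k x)) \<noteq> \<infinity>"
    by (rule nn_integral_PInf_AE[rotated]) measurable
  then have conv: "AE x in M. (\<lambda>k. u (r k) x) \<longlonglongrightarrow> lim (\<lambda>k. u (r k) x)"
  proof eventually_elim
    case (elim x)
    have "summable (\<lambda>k. d k x)"
      using elim by (intro summable_suminf_not_top) (simp_all add: d_def)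
    then have "summable (\<lambda>k. u (r (Suc k)) x - u (r k) x)"
      unfolding d_def by (rule summable_rabs_cancel)
    then have "convergent (\<lambda>n. (\<Sum>k<n. u (r (Suc k)) x - u (r k) x))"
      by (simp add: summable_iff_convergent)
    then have "convergent (\<lambda>n. u (r n) x - u (r 0) x)"
      by (simp only: sum_lessThan_telescope[of "\<lambda>k. u (r k) x"])
    then have "convergent (\<lambda>n. u (r n) x)"
      by (simp add: convergent_diff_const_right_iff)
    then show ?case by (simp add: convergent_LIMSEQ_iff)
  qed
  \<comment> \<open>Being defined everywhere by \<open>lim\<close>, this function is measurable; its
    values where the subsequence diverges concern a null set only.\<close>
  define v where "v x = lim (\<lambda>k. u (r k) x)" for x
  have v[measurable]: "v \<in> borel_measurable M"
    unfolding v_def by measurable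
  \<comment> \<open>For fixed \<open>m\<close> the integrand is almost everywhere the limit along
    the subsequence, whose indices eventually pass \<open>r k\<close> as \<open>m\<close>
    does.\<close>
  have Fatou: "(\<integral>\<^sup>+x. ennreal ((u m x - v x)\<^sup>2) \<partial>M) \<le> ennreal ((1 / 4) ^ k)" if m: "m \<ge> r k" for m k
  proof -
    have "AE x in M. ennreal ((u m x - v x)\<^sup>2) = liminf (\<lambda>j. ennreal ((u m x - u (r j) x)\<^sup>2))"
      using conv
    proof eventually_elim
      case (elim x)
      then have "(\<lambda>j. ennreal ((u m x - u (r j) x)\<^sup>2)) \<longlonglongrightarrow> ennreal ((u m x - v x)\<^sup>2)"
        unfolding v_def by (intro tendsto_intros)
      then show ?case by (rule lim_imp_Liminf[OF sequentially_bot, symmetric])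
    qed
    then have "(\<integral>\<^sup>+x. ennreal ((u m x - v x)\<^sup>2) \<partial>M)
        = (\<integral>\<^sup>+x. liminf (\<lambda>j. ennreal ((u m x - u (r j) x)\<^sup>2)) \<partial>M)"
      by (rule nn_integral_cong_AE)
    also have "\<dots> \<le> liminf (\<lambda>j. \<integral>\<^sup>+x. ennreal ((u m x - u (r j) x)\<^sup>2) \<partial>M)"
      by (rule nn_integral_liminf) measurable
    also have "\<dots> \<le> liminf (\<lambda>j. ennreal ((1 / 4) ^ k))"
    proof (rule Liminf_mono)
      have "(\<integral>\<^sup>+x. ennreal ((u m x - u (r j) x)\<^sup>2) \<partial>M) \<le> ennreal ((1 / 4) ^ k)" if "j \<ge> k" for j
      proof -
        have "r j \<ge> r k" using that mono by (simp add: strict_mono_less_eq)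
        then have "(\<integral>x. (u m x - u (r j) x)\<^sup>2 \<partial>M) \<le> (1 / 4) ^ k"
          using r[OF m] by (simp add: less_imp_le)
        then show ?thesis
          by (subst nn_integral_eq_integral[OF sqdiff]) (auto intro: ennreal_leI)
      qed
      then show "\<forall>\<^sub>F j in sequentially. (\<integral>\<^sup>+x. ennreal ((u m x - u (r j) x)\<^sup>2) \<partial>M) \<le> ennreal ((1 / 4) ^ k)"
        by (auto simp: eventually_sequentially)
    qed
    also have "\<dots> = ennreal ((1 / 4) ^ k)" by (simp add: Liminf_const)
    finally show ?thesis .
  qed
  have int: "integrable M (\<lambda>x. (u m x - v x)\<^sup>2)" if "m \<ge> r k" for m k
    using le_less_trans[OF Fatou[OF that]] by (intro integrableI_nonneg) (auto simp: ennreal_less_top)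
  have "integrable M (\<lambda>x. (v x)\<^sup>2)"
  proof (rule Bochner_Integration.integrable_bound)
    show "integrable M (\<lambda>x. 2 * (u (r 0) x)\<^sup>2 + 2 * (u (r 0) x - v x)\<^sup>2)"
      using sq int[of 0 "r 0"] by simp
    \<comment> \<open>The right side minus the left side is the square of
      \<open>2 * u (r 0) x - v x\<close>.\<close>
    have "(v x)\<^sup>2 \<le> 2 * (u (r 0) x)\<^sup>2 + 2 * (u (r 0) x - v x)\<^sup>2" for x
      using zero_le_power2[of "2 * u (r 0) x - v x"]
      by (simp add: power2_eq_square algebra_simps)
    then show "AE x in M. norm ((v x)\<^sup>2) \<le> norm (2 * (u (r 0) x)\<^sup>2 + 2 * (u (r 0) x - v x)\<^sup>2)"
      by simp
  qed measurable
  moreover have "(\<lambda>n. \<integral>x. (u n x - v x)\<^sup>2 \<partial>M) \<longlonglongrightarrow> 0"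
  proof (rule LIMSEQ_I)
    fix e :: real assume "e > 0"
    then obtain k where k: "(1 / 4) ^ k < e"
      using real_arch_pow_inv[of e "1 / 4"] by auto
    have "norm ((\<integral>x. (u n x - v x)\<^sup>2 \<partial>M) - 0) < e" if n: "n \<ge> r k" for n
      using Fatou[OF n] k by (simp add: nn_integral_eq_integral[OF int[OF n]])
    then show "\<exists>N. \<forall>n\<ge>N. norm ((\<integral>x. (u n x - v x)\<^sup>2 \<partial>M) - 0) < e" by blast
  qed
  ultimately show thesis using that v by blast
qed

section \<open>Representatives of classes and the weighted inner product\<close>

lemmas [measurable] = fn_of_measurable

lemma lfun_eqI: "(AE x in lebesgue. fn_of f x = fn_of g x) \<Longrightarrow> f = g"
  using Quotient3_rel_rep[OF Quotient3_lfun, of f g] fn_of_measurable by (simp add: ae_eq_def)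

text \<open>Representatives are picked by choice, so an algebraic law of the classes holds for them
  only almost everywhere.\<close>

lemma fn_of_add: "AE x in lebesgue. fn_of (f + g) x = fn_of f x + fn_of g x"
proof -
  have "cls_of (\<lambda>x. fn_of f x + fn_of g x) = f + g"
    using plus_lfun.abs_eq[of "fn_of f" "fn_of g"]
    by (simp add: ae_eq_def fn_of_measurable cls_of_fn_of)
  then show ?thesis
    using fn_of_cls_of[of "\<lambda>x. fn_of f x + fn_of g x"] fn_of_measurable by simp
qed

lemma fn_of_scaleR: "AE x in lebesgue. fn_of (c *\<^sub>R f) x = c * fn_of f x"
proof -
  have "cls_of (\<lambda>x. c * fn_of f x) = c *\<^sub>R f"
    using scaleR_lfun.abs_eq[of "fn_of f" c]
    by (simp add: ae_eq_def fn_of_measurable cls_of_fn_of)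
  then show ?thesis
    using fn_of_cls_of[of "\<lambda>x. c * fn_of f x"] fn_of_measurable by simp
qed

lemma fn_of_zero: "AE x in lebesgue. fn_of 0 x = 0"
  using fn_of_scaleR[of 0 0] by simp

lemma fn_of_diff: "AE x in lebesgue. fn_of (f - g) x = fn_of f x - fn_of g x"
  using fn_of_add[of "f - g" g] by eventually_elim simp

lemma integrable_mult_of_squares:
  fixes f g :: "'a \<Rightarrow> real"
  assumes [measurable]: "f \<in> borel_measurable M" "g \<in> borel_measurable M"
    and "integrable M (\<lambda>x. (f x)\<^sup>2)" "integrable M (\<lambda>x. (g x)\<^sup>2)"
  shows "integrable M (\<lambda>x. f x * g x)"
proof (rule Bochner_Integration.integrable_bound)
  show "integrable M (\<lambda>x. (f x)\<^sup>2 + (g x)\<^sup>2)" using assms by simp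
  have "\<bar>f x * g x\<bar> \<le> (f x)\<^sup>2 + (g x)\<^sup>2" for x
    using sum_squares_bound[of "\<bar>f x\<bar>" "\<bar>g x\<bar>"] abs_ge_zero[of "f x * g x"]
    unfolding abs_mult power2_abs by linarith
  then show "AE x in M. norm (f x * g x) \<le> norm ((f x)\<^sup>2 + (g x)\<^sup>2)" by simp
qed measurable

text \<open>On the compact interval \<rho> is continuous and positive, hence bounded between
  positive constants. The weighted product is thus the plain one for a finite measure
  \<open>M\<close> with density \<open>w\<close>, and membership in \<open>L2 a b\<close> can be
  tested with \<open>M\<close>.\<close>

lemma hilbert_carrier_L2:
  fixes \<rho> :: "real \<Rightarrow> real"
  assumes \<rho>: "continuous_on {a..b} \<rho>" and pos: "\<And>z. z \<in> {a..b} \<Longrightarrow> \<rho> z > 0"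
  shows "hilbert_carrier (L2 a b) (ip_weighted a b \<rho>)"
proof -
  let ?I = "indicator {a..b} :: real \<Rightarrow> real"
  define w where "w z = ?I z * \<rho> z" for z
  define M where "M = density lebesgue (\<lambda>z. ennreal (w z))"
  have wm[measurable]: "w \<in> borel_measurable lebesgue"
    unfolding w_def
    using borel_measurable_continuous_on_indicator[OF _ \<rho>] by (auto intro: measurable_completion)
  have w0: "w z \<ge> 0" for z using pos[of z] by (simp add: w_def indicator_def less_imp_le)
  have "\<exists>c C. 0 < c \<and> 0 < C \<and> (\<forall>z\<in>{a..b}. c \<le> \<rho> z \<and> \<rho> z \<le> C)"
  proof (cases "{a..b} = {}")
    case True
    then show ?thesis by (intro exI[of _ 1]) simp
  next
    case False
    obtain z\<^sub>0 z\<^sub>1 where "z\<^sub>0 \<in> {a..b}" "\<forall>z\<in>{a..b}. \<rho> z\<^sub>0 \<le> \<rho> z" "z\<^sub>1 \<in> {a..b}" "\<forall>z\<in>{a..b}. \<rho> z \<le> \<rho> z\<^sub>1"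
      using continuous_attains_inf[OF compact_Icc False \<rho>] continuous_attains_sup[OF compact_Icc False \<rho>]
      by blast
    then show ?thesis using pos by blast
  qed
  then obtain c C where c: "c > 0" and C: "C > 0" and cC: "\<And>z. z \<in> {a..b} \<Longrightarrow> c \<le> \<rho> z \<and> \<rho> z \<le> C"
    by blast
  have sets_M[measurable_cong]: "sets M = sets lebesgue" by (simp add: M_def)
  have AE_M: "AE x in M. P x" if "AE x in lebesgue. P x" for P
    using that unfolding M_def by (subst AE_density) (auto elim: eventually_mono)
  have integrable_M: "integrable M f \<longleftrightarrow> integrable lebesgue (\<lambda>z. w z * f z)"
    if "f \<in> borel_measurable lebesgue" for f :: "real \<Rightarrow> real"
    using that w0 unfolding M_def by (subst integrable_density) auto
  have ip_eq: "ip_weighted a b \<rho> f g = (\<integral>x. fn_of f x * fn_of g x \<partial>M)" for f g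
  proof -
    have "(\<integral>x. fn_of f x * fn_of g x \<partial>M) = (\<integral>x. w x * (fn_of f x * fn_of g x) \<partial>lebesgue)"
      using w0 unfolding M_def by (subst integral_density) auto
    then show ?thesis
      by (simp add: ip_weighted_def set_lebesgue_integral_def w_def mult_ac)
  qed
  have "integrable lebesgue w"
    unfolding w_def using borel_integrable_atLeastAtMost'[OF \<rho>]
    by (simp add: set_integrable_def integrable_completion)
  then have "integrable M (\<lambda>_. 1 :: real)"
    by (simp add: integrable_M)
  then have fin: "finite_measure M"
    by (intro finite_measureI) (auto simp: integrable_iff_bounded top.not_eq_extremum)
  \<comment> \<open>\<open>L2\<close> is defined with the unweighted integral, and the bounds
    \<open>c\<close> and \<open>C\<close> on \<rho> convert between the two. Outside the interval,
    where \<open>w\<close> vanishes, the conversion back rests on the support condition.\<close>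
  have L2_iff: "f \<in> L2 a b \<longleftrightarrow> (AE z in lebesgue. z \<notin> {a..b} \<longrightarrow> fn_of f z = 0) \<and>
      integrable M (\<lambda>z. (fn_of f z)\<^sup>2)" for f
  proof -
    have "integrable lebesgue (\<lambda>z. (fn_of f z)\<^sup>2) \<longleftrightarrow> integrable lebesgue (\<lambda>z. w z * (fn_of f z)\<^sup>2)"
      if "AE z in lebesgue. z \<notin> {a..b} \<longrightarrow> fn_of f z = 0"
    proof
      assume "integrable lebesgue (\<lambda>z. (fn_of f z)\<^sup>2)"
      then have "integrable lebesgue (\<lambda>z. C * (fn_of f z)\<^sup>2)" by simp
      then show "integrable lebesgue (\<lambda>z. w z * (fn_of f z)\<^sup>2)"
      proof (rule Bochner_Integration.integrable_bound)
        have "w z \<le> C" for z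
          using cC[of z] C by (cases "z \<in> {a..b}") (auto simp: w_def)
        then have "w z * (fn_of f z)\<^sup>2 \<le> C * (fn_of f z)\<^sup>2" for z
          by (intro mult_right_mono) auto
        then show "AE z in lebesgue. norm (w z * (fn_of f z)\<^sup>2) \<le> norm (C * (fn_of f z)\<^sup>2)"
          using w0 C by simp
      qed measurable
    next
      assume "integrable lebesgue (\<lambda>z. w z * (fn_of f z)\<^sup>2)"
      then have "integrable lebesgue (\<lambda>z. w z * (fn_of f z)\<^sup>2 / c)" by simp
      then show "integrable lebesgue (\<lambda>z. (fn_of f z)\<^sup>2)"
      proof (rule Bochner_Integration.integrable_bound)
        show "AE z in lebesgue. norm ((fn_of f z)\<^sup>2) \<le> norm (w z * (fn_of f z)\<^sup>2 / c)"
          using that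
        proof eventually_elim
          case (elim z)
          show ?case
          proof (cases "z \<in> {a..b}")
            case True
            then have "c * (fn_of f z)\<^sup>2 \<le> w z * (fn_of f z)\<^sup>2"
              using cC by (intro mult_right_mono) (auto simp: w_def)
            then show ?thesis using c w0[of z] by (simp add: field_simps)
          qed (use elim in simp)
        qed
      qed measurable
    qed
    then show ?thesis by (auto simp: L2_def integrable_M)
  qed
  have L2_sq: "integrable M (\<lambda>z. (fn_of f z)\<^sup>2)" if "f \<in> L2 a b" for f
    using that L2_iff by blast
  have L2_mult: "integrable M (\<lambda>z. fn_of f z * fn_of g z)" if "f \<in> L2 a b" "g \<in> L2 a b" for f g
    using that L2_sq by (intro integrable_mult_of_squares) auto
  have diff_sq: "(ip_norm (ip_weighted a b \<rho>) (f - g))\<^sup>2 = (\<integral>x. (fn_of f x - fn_of g x)\<^sup>2 \<partial>M)" for f g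
  proof -
    have "ip_weighted a b \<rho> (f - g) (f - g) = (\<integral>x. (fn_of f x - fn_of g x)\<^sup>2 \<partial>M)"
      unfolding ip_eq
      by (rule integral_cong_AE) (use AE_M[OF fn_of_diff[of f g]] in \<open>auto simp: power2_eq_square\<close>)
    then show ?thesis by (simp add: ip_norm_def)
  qed
  have subspace: "subspace (L2 a b)"
    unfolding subspace_def
  proof (intro conjI ballI allI)
    have "integrable M (\<lambda>z. (fn_of 0 z)\<^sup>2) \<longleftrightarrow> integrable M (\<lambda>z. 0 :: real)"
      by (rule integrable_cong_AE) (use AE_M[OF fn_of_zero] in auto)
    then show "0 \<in> L2 a b"
      using fn_of_zero by (auto simp: L2_iff elim: eventually_mono)
  next
    fix f g assume fg: "f \<in> L2 a b" "g \<in> L2 a b"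
    have "integrable M (\<lambda>z. (fn_of (f + g) z)\<^sup>2) \<longleftrightarrow>
        integrable M (\<lambda>z. (fn_of f z)\<^sup>2 + (fn_of g z)\<^sup>2 + 2 * (fn_of f z * fn_of g z))"
      by (rule integrable_cong_AE) (use AE_M[OF fn_of_add[of f g]] in \<open>auto simp: power2_sum\<close>)
    moreover have "integrable M (\<lambda>z. (fn_of f z)\<^sup>2 + (fn_of g z)\<^sup>2 + 2 * (fn_of f z * fn_of g z))"
      using L2_sq L2_mult fg by simp
    moreover have "AE z in lebesgue. z \<notin> {a..b} \<longrightarrow> fn_of (f + g) z = 0"
      using fn_of_add[of f g] fg[unfolded L2_iff] by (auto elim!: eventually_elim2)
    ultimately show "f + g \<in> L2 a b" by (simp add: L2_iff)
  next
    fix k :: real and f assume f: "f \<in> L2 a b"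
    have "integrable M (\<lambda>z. (fn_of (k *\<^sub>R f) z)\<^sup>2) \<longleftrightarrow> integrable M (\<lambda>z. k\<^sup>2 * (fn_of f z)\<^sup>2)"
      by (rule integrable_cong_AE)
        (use AE_M[OF fn_of_scaleR[of k f]] in \<open>auto simp: power_mult_distrib\<close>)
    moreover have "AE z in lebesgue. z \<notin> {a..b} \<longrightarrow> fn_of (k *\<^sub>R f) z = 0"
      using fn_of_scaleR[of k f] f[unfolded L2_iff] by (auto elim!: eventually_elim2)
    ultimately show "k *\<^sub>R f \<in> L2 a b" using L2_sq[OF f] by (simp add: L2_iff)
  qed
  show ?thesis
  proof
    show "subspace (L2 a b)" by (rule subspace)
  next
    fix f g assume "f \<in> L2 a b" "g \<in> L2 a b"
    show "ip_weighted a b \<rho> f g = ip_weighted a b \<rho> g f" by (simp add: ip_eq mult.commute)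
  next
    fix f g h assume f: "f \<in> L2 a b" "g \<in> L2 a b" "h \<in> L2 a b"
    have "ip_weighted a b \<rho> (f + g) h = (\<integral>x. fn_of f x * fn_of h x + fn_of g x * fn_of h x \<partial>M)"
      unfolding ip_eq
      by (rule integral_cong_AE) (use AE_M[OF fn_of_add[of f g]] in \<open>auto simp: distrib_right\<close>)
    then show "ip_weighted a b \<rho> (f + g) h = ip_weighted a b \<rho> f h + ip_weighted a b \<rho> g h"
      using f L2_mult by (simp add: ip_eq)
  next
    fix f g and k :: real assume f: "f \<in> L2 a b" "g \<in> L2 a b"
    have "ip_weighted a b \<rho> (k *\<^sub>R f) g = (\<integral>x. k * (fn_of f x * fn_of g x) \<partial>M)"
      unfolding ip_eq
      by (rule integral_cong_AE) (use AE_M[OF fn_of_scaleR[of k f]] in auto)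
    then show "ip_weighted a b \<rho> (k *\<^sub>R f) g = k * ip_weighted a b \<rho> f g"
      by (simp add: ip_eq)
  next
    fix f assume f: "f \<in> L2 a b" "f \<noteq> 0"
    have "ip_weighted a b \<rho> f f \<noteq> 0"
    proof
      assume "ip_weighted a b \<rho> f f = 0"
      then have "AE x in M. fn_of f x * fn_of f x = 0"
        using integral_nonneg_eq_0_iff_AE[OF L2_mult[OF f(1) f(1)]] by (simp add: ip_eq)
      \<comment> \<open>A null integral controls \<open>f\<close> only where the density is
        positive, that is on the interval; elsewhere the support condition takes over.\<close>
      then have "AE x in lebesgue. 0 < ennreal (w x) \<longrightarrow> fn_of f x * fn_of f x = 0"
        unfolding M_def by (subst (asm) AE_density) auto
      then have "AE x in lebesgue. fn_of f x = fn_of 0 x"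
        using f(1)[unfolded L2_iff, THEN conjunct1] fn_of_zero
      proof eventually_elim
        case (elim x)
        then show ?case using pos[of x] by (cases "x \<in> {a..b}") (auto simp: w_def)
      qed
      then show False using f(2) lfun_eqI by blast
    qed
    moreover have "ip_weighted a b \<rho> f f \<ge> 0" by (simp add: ip_eq)
    ultimately show "ip_weighted a b \<rho> f f > 0" by simp
  next
    fix s :: "nat \<Rightarrow> lfun"
    assume s: "\<And>n. s n \<in> L2 a b"
      and Cauchy: "\<And>e. e > 0 \<Longrightarrow>
        \<exists>N. \<forall>m\<ge>N. \<forall>n\<ge>N. ip_norm (ip_weighted a b \<rho>) (s m - s n) < e"
    have nonneg: "ip_norm (ip_weighted a b \<rho>) f \<ge> 0" for f
      by (simp add: ip_norm_def ip_eq)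
    obtain v where v: "v \<in> borel_measurable M" "integrable M (\<lambda>x. (v x)\<^sup>2)"
      and lim: "(\<lambda>n. \<integral>x. (fn_of (s n) x - v x)\<^sup>2 \<partial>M) \<longlonglongrightarrow> 0"
    proof (rule L2_completeness[OF fin, of "\<lambda>n. fn_of (s n)"])
      fix e :: real assume "e > 0"
      then obtain N where N: "\<And>m n. \<lbrakk>m \<ge> N; n \<ge> N\<rbrakk> \<Longrightarrow> ip_norm (ip_weighted a b \<rho>) (s m - s n) < sqrt e"
        using Cauchy[of "sqrt e"] by auto
      have "(\<integral>x. (fn_of (s m) x - fn_of (s n) x)\<^sup>2 \<partial>M) < e" if "m \<ge> N" "n \<ge> N" for m n
        using power_strict_mono[OF N[OF that] nonneg, of 2] \<open>e > 0\<close> by (simp add: diff_sq)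
      then show "\<exists>K. \<forall>m\<ge>K. \<forall>n\<ge>K. (\<integral>x. (fn_of (s m) x - fn_of (s n) x)\<^sup>2 \<partial>M) < e" by blast
    qed (use s L2_sq in auto)
    \<comment> \<open>The limit \<open>v\<close> is arbitrary outside the interval, which
      \<open>M\<close> does not see; cutting it off enforces the support condition without changing
      it almost everywhere for \<open>M\<close>.\<close>
    define f where "f = class_on a b v"
    have v_lebesgue[measurable]: "v \<in> borel_measurable lebesgue"
      using v(1) by (simp only: measurable_cong_sets[OF sets_M refl])
    have fn: "AE x in lebesgue. fn_of f x = ?I x * v x"
      unfolding f_def class_on_def by (intro fn_of_cls_of borel_measurable_times borel_measurable_indicator v_lebesgue) simp
    have fn_M: "AE x in M. fn_of f x = v x"
    proof -
      have "AE x in M. x \<in> {a..b}"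
      proof -
        have "0 < w x \<Longrightarrow> x \<in> {a..b}" for x by (cases "x \<in> {a..b}") (auto simp: w_def)
        then show ?thesis unfolding M_def by (subst AE_density) auto
      qed
      then show ?thesis using AE_M[OF fn] by eventually_elim simp
    qed
    have "integrable M (\<lambda>x. (fn_of f x)\<^sup>2) \<longleftrightarrow> integrable M (\<lambda>x. (v x)\<^sup>2)"
      by (rule integrable_cong_AE) (use fn_M in auto)
    then have "f \<in> L2 a b"
      using v(2) fn by (auto simp: L2_iff elim: eventually_mono)
    moreover have "(\<lambda>n. ip_norm (ip_weighted a b \<rho>) (s n - f)) \<longlonglongrightarrow> 0"
    proof -
      have "(ip_norm (ip_weighted a b \<rho>) (s n - f))\<^sup>2 = (\<integral>x. (fn_of (s n) x - v x)\<^sup>2 \<partial>M)" for n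
        unfolding diff_sq by (rule integral_cong_AE) (use fn_M in auto)
      then have "(\<lambda>n. sqrt ((ip_norm (ip_weighted a b \<rho>) (s n - f))\<^sup>2)) \<longlonglongrightarrow> sqrt 0"
        using lim by (intro tendsto_real_sqrt) simp
      then show ?thesis using nonneg by simp
    qed
    ultimately show "\<exists>f\<in>L2 a b. (\<lambda>n. ip_norm (ip_weighted a b \<rho>) (s n - f)) \<longlonglongrightarrow> 0"
      by blast
  qed
qed

subsection \<open>Sturm-Liouville semigroups\<close>

theorem mainTheorem6:
  fixes a b \<alpha>\<^sub>a \<beta>\<^sub>a \<alpha>\<^sub>b \<beta>\<^sub>b \<gamma> \<epsilon> \<mu> \<alpha> :: real
    and p q \<rho> :: "real \<Rightarrow> real"
    and lam :: "nat \<Rightarrow> real"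
    and \<phi> :: "nat \<Rightarrow> lfun"
    and A :: "lfun \<Rightarrow> lfun"
    and dom_A X X\<^sub>\<alpha> :: "lfun set"
    and ip ip\<^sub>\<alpha> :: "lfun \<Rightarrow> lfun \<Rightarrow> real"
    and T :: "real \<Rightarrow> lfun \<Rightarrow> lfun"
  assumes "a < b"
    and "continuous_on {a..b} p"
    and "p differentiable_on {a..b}" and "continuous_on {a..b} (D a b p)"
    and "continuous_on {a..b} q"
    and "continuous_on {a..b} \<rho>"
    and "\<And>z. z \<in> {a..b} \<Longrightarrow> p z > 0"
    and "\<And>z. z \<in> {a..b} \<Longrightarrow> \<rho> z > 0"
    and "(\<alpha>\<^sub>a, \<beta>\<^sub>a) \<noteq> (0, 0)" and "(\<alpha>\<^sub>b, \<beta>\<^sub>b) \<noteq> (0, 0)"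
  defines "X \<equiv> L2 a b"
    and "ip \<equiv> ip_weighted a b \<rho>"
    and "A \<equiv> (\<lambda>f. - SL_op a b p q \<rho> f)"
    and "dom_A \<equiv> SL_domain a b \<alpha>\<^sub>a \<beta>\<^sub>a \<alpha>\<^sub>b \<beta>\<^sub>b"
  assumes "inj lam" and "range lam = eigenvalues dom_A A"
    and "orthonormal_basis X ip \<phi>"
    and "\<And>n. \<phi> n \<in> dom_A \<and> A (\<phi> n) = lam n *\<^sub>R \<phi> n"
    and "\<epsilon> > 0" and "\<And>n. lam n < \<gamma>" and "\<mu> = \<gamma> + \<epsilon>"
    and "\<alpha> > 0"
  defines "X\<^sub>\<alpha> \<equiv> X_frac X ip lam \<phi> \<mu> \<alpha>"
    and "ip\<^sub>\<alpha> \<equiv> ip_frac X ip lam \<phi> \<mu> \<alpha>"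
  assumes "generates X\<^sub>\<alpha> (ip_norm ip\<^sub>\<alpha>) (domain_frac X ip lam \<phi> \<mu> \<alpha>) A T"
  shows "(\<forall>t>0. compact_operator X\<^sub>\<alpha> (ip_norm ip\<^sub>\<alpha>) (T t)) \<longleftrightarrow> (\<lambda>n. exp (lam n)) \<longlonglongrightarrow> 0"
proof -
  interpret X: hilbert_carrier X ip
    unfolding X_def ip_def using assms(6,8) by (rule hilbert_carrier_L2)
  interpret X: hilbert_basis X ip \<phi>
    by unfold_locales (rule assms)
  \<comment> \<open>These four facts on \<epsilon>, \<gamma>, \<mu> and \<alpha> are the standing
    assumptions of the results on fractional powers.\<close>
  note weight = assms(19-22)
  interpret V: hilbert_basis X\<^sub>\<alpha> ip\<^sub>\<alpha> "phi_frac lam \<phi> \<mu> \<alpha>"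
    unfolding X\<^sub>\<alpha>_def ip\<^sub>\<alpha>_def using weight by (rule X.hilbert_basis_X_frac)
  have T: "C0_semigroup X\<^sub>\<alpha> V.nrm T"
    and graph: "generator_graph X\<^sub>\<alpha> V.nrm T = {(f, A f) | f. f \<in> domain_frac X ip lam \<phi> \<mu> \<alpha>}"
    using \<open>generates _ _ _ _ _\<close> by (auto simp: generates_def)
  have "T t (phi_frac lam \<phi> \<mu> \<alpha> n) = exp (lam n * t) *\<^sub>R phi_frac lam \<phi> \<mu> \<alpha> n" if "t \<ge> 0" for t n
  proof -
    \<comment> \<open>The action of \<open>A\<close> is given on \<open>\<phi> n\<close>; the
      rescaling to \<open>phi_frac\<close> is left to \<open>T t\<close>, which is linear as a
      bounded operator.\<close>
    have "A (\<phi> n) = lam n *\<^sub>R \<phi> n" using assms by blast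
    moreover have "\<phi> n \<in> domain_frac X ip lam \<phi> \<mu> \<alpha>"
      using weight by (rule X.basis_in_domain_frac)
    ultimately have "(\<phi> n, lam n *\<^sub>R \<phi> n) \<in> generator_graph X\<^sub>\<alpha> V.nrm T"
      unfolding graph by force
    then have "T t (\<phi> n) = exp (lam n * t) *\<^sub>R \<phi> n"
      using V.semigroup_eigenvector[OF T _ that] by blast
    moreover have "\<phi> n \<in> X\<^sub>\<alpha>"
      unfolding X\<^sub>\<alpha>_def using weight by (rule X.frac_power_basis[THEN conjunct1])
    moreover have "bounded_operator X\<^sub>\<alpha> V.nrm (T t)"
      using T that by (simp add: C0_semigroup_def)
    ultimately show ?thesis
      by (simp add: phi_frac_def V.bounded_operatorD(3))
  qed
  with T show ?thesis
    by (rule V.compact_semigroup_iff)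
qed

end
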